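(* For every positive integer $n$, $F_5(n)\geq\left\lfloor\frac{5n}{47}\right\rfloor$.
   Context: A finite set of points in the plane is in general position if no three of its points lie on a line. For a finite point set $S$ in the plane in general position, a $k$-hole (empty convex $k$-gon) of $S$ is a subset of $k$ points of $S$ which are the vertices of a convex $k$-gon whose interior contains no points of $S$. Two holes are disjoint if their convex hulls do not intersect. For positive integers $k$ and $n$, $F_k(n)$ denotes the minimum, over all sets $S$ of $n$ points in the plane in general position, of the maximum number of pairwise disjoint $k$-holes of $S$. *)

theory Defs
  imports "HOL-Analysis.Analysis"
begin

definition general_position :: "(real^2) set \<Rightarrow> bool" where
  "general_position S \<longleftrightarrow> finite S \<and> (\<forall>T\<subseteq>S. card T = 3 \<longrightarrow> \<not> collinear T)"

text \<open>The first three conjuncts say that \<open>H\<close> is the vertex set of a convex \<open>k\<close>-gon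
  (for \<open>k \<ge> 3\<close>), namely of \<open>convex hull H\<close>.\<close>

definition is_hole :: "nat \<Rightarrow> (real^2) set \<Rightarrow> (real^2) set \<Rightarrow> bool" where
  "is_hole k S H \<longleftrightarrow> H \<subseteq> S \<and> card H = k
     \<and> {v. v extreme_point_of (convex hull H)} = H
     \<and> interior (convex hull H) \<inter> S = {}"

definition disjoint_holes :: "nat \<Rightarrow> (real^2) set \<Rightarrow> (real^2) set set \<Rightarrow> bool" where
  "disjoint_holes k S \<H> \<longleftrightarrow>
     (\<forall>H\<in>\<H>. is_hole k S H) \<and> disjoint_family_on (\<lambda>H. convex hull H) \<H>"

text \<open>For finite \<open>S\<close>, the set below is finite (all families are contained in \<open>Pow S\<close>)
  and nonempty (it contains \<open>card {}\<close>), so \<open>Max\<close> is a genuine maximum.\<close>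

definition max_disjoint_holes :: "nat \<Rightarrow> (real^2) set \<Rightarrow> nat" where
  "max_disjoint_holes k S = Max {card \<H> |\<H>. disjoint_holes k S \<H>}"

text \<open>The infimum is a minimum: it ranges over a set of natural numbers, which is nonempty
  since there are \<open>n\<close>-point sets in general position for every \<open>n\<close> (e.g. on a parabola).\<close>

definition F :: "nat \<Rightarrow> nat \<Rightarrow> nat" where
  "F k n = Inf {max_disjoint_holes k S |S. general_position S \<and> card S = n}"

end

theory Submission
  imports Defs
begin

text \<open>
  Call a finite point set hole-free if it has no 5-hole. If a line separates two parts of a set,
  then their holes are disjoint, and a set can be cut into parts of prescribed sizes with
  disjoint convex hulls. So the bound follows by arithmetic once parts of 10, 19 and 47 points are
  known to have 1, 2 and 5 disjoint holes.

  The engine is a fact about nine points: the convex hull of nine hole-free points is a triangle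
  (\<open>nine_points_hull_triangle\<close>). This fact, Harborth's theorem for ten points and the impossibility
  of a certain configuration of eleven points only concern the orientations of finitely many
  triples. Points sorted by angle around a hull vertex satisfy the signotope axioms, and an empty
  pentagon consists of an upper and a lower chain without a point between them. In this form the
  three statements are propositional formulas, which are refuted by resolution.

  Suppose that 19 points have no two disjoint holes. Then every nine points that are cut off by a
  line are hole-free, because the other ten contain a hole. Let \<open>s t\<close> be an edge of the convex hull
  and let \<open>P\<close> consist of \<open>s\<close> and the first seven points around \<open>s\<close>, starting with \<open>t\<close>. Applying the
  fact about nine points to \<open>P\<close> and the point in which an inner common tangent of \<open>P\<close> and the rest
  touches the rest shows that \<open>P\<close> also comes first around \<open>t\<close> (\<open>core\<close>). Hence each hull edge has a
  core of six points that come first around both its ends. Cores of different edges are disjoint,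
  and three consecutive edges already require more than 19 points.

  Suppose that 47 points have no five disjoint holes. Then nine points that can be cut off between
  two parts of 19 points are hole-free. Around a hull vertex there are three such windows, which
  overlap in the points in the middle, and the core argument applied from the left and from the
  right restricts these points further. What remains is the impossible configuration of eleven
  points.
\<close>

section \<open>Signotopes and their pentagons\<close>

text \<open>\<open>between x y z\<close> excludes the two alternating sign patterns of \<open>x, y, z\<close>, so a list of
truth values all of whose sublists of length three satisfy it changes its value at most once.\<close>

definition between :: "bool \<Rightarrow> bool \<Rightarrow> bool \<Rightarrow> bool" where
  "between x y z \<longleftrightarrow> (x \<and> z \<longrightarrow> y) \<and> (y \<longrightarrow> x \<or> z)"

text \<open>Points sorted by increasing angle around a vertex of their convex hull behave like points sorted
by a coordinate, with ``above'' meaning ``on the far side from the vertex''. If \<open>s i j k\<close> (for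
\<open>i < j < k\<close>) says that the point \<open>j\<close> is above the line \<open>i k\<close>, then the four triples of
any four points, in lexicographic order, change their value at most once. This is the only
property of the plane that the combinatorial part uses.\<close>

definition signotope :: "nat \<Rightarrow> (nat \<Rightarrow> nat \<Rightarrow> nat \<Rightarrow> bool) \<Rightarrow> bool" where
  "signotope n s \<longleftrightarrow> (\<forall>d<n. \<forall>c<d. \<forall>b<c. \<forall>a<b.
     between (s a b c) (s a b d) (s a c d) \<and> between (s a b c) (s a b d) (s b c d) \<and>
     between (s a b c) (s a c d) (s b c d) \<and> between (s a b d) (s a c d) (s b c d))"

text \<open>For the vertices \<open>u \<dots> w\<close> of an \<open>x\<close>-monotone chain in increasing order, \<open>side s\<close> says that \<open>x\<close> is no
vertex of the chain and lies above the chain segment that spans it. The version below the chain is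
obtained by negating \<open>s\<close>.\<close>

fun side :: "(nat \<Rightarrow> nat \<Rightarrow> nat \<Rightarrow> bool) \<Rightarrow> nat list \<Rightarrow> nat \<Rightarrow> bool" where
  "side s (u # w # r) x = (if x < w then s u x w else x \<noteq> w \<and> side s (w # r) x)"
| "side s _ x = False"

fun turns :: "(nat \<Rightarrow> nat \<Rightarrow> nat \<Rightarrow> bool) \<Rightarrow> nat list \<Rightarrow> bool" where
  "turns s (u # v # w # r) = (s u v w \<and> turns s (v # w # r))"
| "turns s _ = True"

text \<open>A convex pentagon with first vertex \<open>a\<close> and last vertex \<open>e\<close> consists of a concave upper
chain through \<open>U\<close> and a convex lower chain through \<open>L\<close>. A further point is inside if and only if it
is between \<open>a\<close> and \<open>e\<close>, below the upper and above the lower chain.\<close>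

definition filled ::
  "(nat \<Rightarrow> nat \<Rightarrow> nat \<Rightarrow> bool) \<Rightarrow> nat \<Rightarrow> nat list \<Rightarrow> nat list \<Rightarrow> nat \<Rightarrow> bool" where
  "filled s a U L e \<longleftrightarrow>
     (turns s (a # U @ [e]) \<and> turns (\<lambda>i j k. \<not> s i j k) (a # L @ [e]) \<longrightarrow>
      (\<exists>x<e. a < x \<and> side (\<lambda>i j k. \<not> s i j k) (a # U @ [e]) x \<and> side s (a # L @ [e]) x))"

text \<open>The eight conjuncts are the eight ways to distribute the three middle vertices of a pentagon over
its upper and its lower chain.\<close>

definition pentagons_filled :: "nat \<Rightarrow> (nat \<Rightarrow> nat \<Rightarrow> nat \<Rightarrow> bool) \<Rightarrow> bool" where
  "pentagons_filled n s \<longleftrightarrow> (\<forall>e<n. \<forall>d<e. \<forall>c<d. \<forall>b<c. \<forall>a<b.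
     filled s a [b,c,d] [] e \<and> filled s a [c,d] [b] e \<and> filled s a [b,d] [c] e \<and>
     filled s a [b,c] [d] e \<and> filled s a [d] [b,c] e \<and> filled s a [c] [b,d] e \<and>
     filled s a [b] [c,d] e \<and> filled s a [] [b,c,d] e)"

text \<open>The vertex around which the points are sorted can itself take part as the point \<open>0\<close>: think of
it as a point far below all the others.\<close>

definition rooted :: "nat \<Rightarrow> (nat \<Rightarrow> nat \<Rightarrow> nat \<Rightarrow> bool) \<Rightarrow> bool" where
  "rooted n s \<longleftrightarrow> (\<forall>k<n. \<forall>j<k. 0 < j \<longrightarrow> s 0 j k)"

text \<open>With the following rules a bounded statement about concrete numerals is rewritten into a
propositional formula whose atoms are the orientations \<open>s i j k\<close>.\<close>

lemma all_less_numeral: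
  "(\<forall>i<numeral v. P i) \<longleftrightarrow> (\<forall>i<pred_numeral v. P i) \<and> P (pred_numeral v)"
  by (simp add: numeral_eq_Suc All_less_Suc conj_commute)

lemma ex_less_numeral:
  "(\<exists>i<numeral v. P i) \<longleftrightarrow> (\<exists>i<pred_numeral v. P i) \<or> P (pred_numeral v)"
  by (simp add: numeral_eq_Suc Ex_less_Suc disj_commute)

lemma all_ex_less_0_1:
  "(\<forall>i<1. P i) \<longleftrightarrow> P (0::nat)" "(\<exists>i<1. P i) \<longleftrightarrow> P (0::nat)"
  "(\<forall>i<0. P (i::nat)) = True" "(\<exists>i<0. P (i::nat)) = False"
  by auto

lemmas unroll = all_less_numeral ex_less_numeral all_ex_less_0_1
  pred_numeral_simps BitM.simps numeral_One
  rel_simps not_less0 zero_less_one simp_thms if_True if_False less_irrefl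

lemmas add_eval = numeral_plus_numeral numeral_plus_one one_plus_numeral one_add_one add_0_left add_num_simps

lemmas unfold_filled = pentagons_filled_def filled_def append.simps side.simps turns.simps

text \<open>The points \<open>0\<close>, \<open>1\<close> and \<open>8\<close> are hull vertices because \<open>1\<close> and \<open>8\<close> are the extreme points around
\<open>0\<close>; the conclusion says that no point is beyond the line \<open>1 8\<close>, so these three are the whole
hull. The set of clauses is refuted by resolution after a short search. Substituting the known
orientations of the triples with \<open>0\<close> beforehand keeps the clauses short.\<close>

lemma nine_points_triangle:
  assumes sig: "signotope 9 s" and root: "rooted 9 s" and filled: "pentagons_filled 9 s"
  shows "\<forall>k<8. 1 < k \<longrightarrow> \<not> s 1 k 8"
proof -
  note r = root[unfolded rooted_def, simplified unroll]
  note f = filled[unfolded unfold_filled, simplified unroll r]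
  note g = sig[unfolded signotope_def between_def, simplified unroll r]
  show ?thesis
    apply (simp only: unroll) using f g by sat
qed

text \<open>This is Harborth's theorem that ten points always span an empty convex pentagon.\<close>

lemma ten_points_impossible:
  assumes sig: "signotope 10 s" and root: "rooted 10 s" and filled: "pentagons_filled 10 s"
  shows False
proof -
  note r = root[unfolded rooted_def, simplified unroll]
  note f = filled[unfolded unfold_filled, simplified unroll r]
  note g = sig[unfolded signotope_def between_def, simplified unroll r]
  show ?thesis using f g by sat
qed

text \<open>The point \<open>0\<close> and the points \<open>2, \<dots>, 9\<close>, renumbered consecutively.\<close>

definition skip :: "nat \<Rightarrow> nat" where
  "skip i = (if i = 0 then 0 else i + 1)"

text \<open>Write \<open>q\<^sub>0, \<dots>, q\<^sub>9\<close> for the points \<open>1, \<dots>, 10\<close>, sorted around the point \<open>0\<close>. The three sets without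
empty pentagon are \<open>{0, q\<^sub>1, \<dots>, q\<^sub>8}\<close>, \<open>{q\<^sub>0, \<dots>, q\<^sub>8}\<close> and \<open>{q\<^sub>1, \<dots>, q\<^sub>9}\<close>, and \<open>q\<^sub>2, \<dots>, q\<^sub>7\<close> are
on the near side of the lines \<open>q\<^sub>0 q\<^sub>8\<close>, \<open>q\<^sub>1 q\<^sub>8\<close> and \<open>q\<^sub>1 q\<^sub>9\<close>. The point sets with more than 19
points are reduced to this configuration.\<close>

lemma eleven_points_impossible:
  assumes sig: "signotope 11 s" and root: "rooted 11 s"
    and filled0: "pentagons_filled 9 (\<lambda>i j k. s (skip i) (skip j) (skip k))"
    and filled1: "pentagons_filled 9 (\<lambda>i j k. s (i + 1) (j + 1) (k + 1))"
    and filled2: "pentagons_filled 9 (\<lambda>i j k. s (i + 2) (j + 2) (k + 2))"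
    and low: "\<forall>k<9. 2 < k \<longrightarrow> \<not> s 1 k 9 \<and> \<not> s 2 k 9 \<and> \<not> s 2 k 10"
  shows False
proof -
  let ?t = "\<lambda>i j k. s (skip i) (skip j) (skip k)"
  note r = root[unfolded rooted_def, simplified unroll]
  note l = low[simplified unroll]
  \<comment> \<open>A pentagon of the first set that avoids the vertex 0 is a pentagon of the second set.\<close>
  have caps: "\<forall>e<9. \<forall>d<e. \<forall>c<d. \<forall>b<c. 0 < b \<longrightarrow> filled ?t 0 [b,c,d] [] e"
    using filled0 unfolding pentagons_filled_def by blast
  note f0 = caps[unfolded unfold_filled skip_def, simplified unroll add_eval r l]
  note f1 = filled1[unfolded unfold_filled, simplified unroll add_eval l]
  note f2 = filled2[unfolded unfold_filled, simplified unroll add_eval l]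
  note g = sig[unfolded signotope_def between_def, simplified unroll r l]
  show ?thesis using f0 f1 f2 g by sat
qed

section \<open>Orientation of triples and separation by lines\<close>

definition ort :: "real^2 \<Rightarrow> real^2 \<Rightarrow> real^2 \<Rightarrow> real" where
  "ort p q r = (q$1 - p$1) * (r$2 - p$2) - (q$2 - p$2) * (r$1 - p$1)"

lemma ort_rotate: "ort q r p = ort p q r"
  unfolding ort_def by (simp add: algebra_simps)

lemma ort_swap: "ort q p r = - ort p q r" "ort p r q = - ort p q r"
  unfolding ort_def by (simp_all add: algebra_simps)

lemma ort_same [simp]: "ort p p q = 0" "ort p q p = 0" "ort q p p = 0"
  unfolding ort_def by simp_all

text \<open>The three-term Pluecker relation and the barycentric relation express the linear dependencies
between orientations. They are used below to derive the sign of one orientation from others.\<close>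

lemma ort_pluecker:
  "ort apex t x * ort apex y z - ort apex t y * ort apex x z + ort apex t z * ort apex x y = 0"
  unfolding ort_def by (simp add: algebra_simps)

lemma ort_barycentric:
  "ort b c x * ort x y a + ort c a x * ort x y b + ort a b x * ort x y c = 0"
  unfolding ort_def by (simp add: algebra_simps)

lemma ort_inner: "ort p q z = vector [p$2 - q$2, q$1 - p$1] \<bullet> z - (q$1 - p$1) * p$2 + (q$2 - p$2) * p$1"
  unfolding ort_def by (simp add: inner_vec_def sum_2 algebra_simps)

lemma vec2_eq_iff: "(p :: real^2) = q \<longleftrightarrow> p$1 = q$1 \<and> p$2 = q$2"
  by (simp add: vec_eq_iff forall_2)

lemma ort_0_imp_collinear:
  assumes "ort a b c = 0" shows "collinear {a, b, c}"
proof (cases "a = b")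
  case False
  have eq: "(b$1 - a$1) * (c$2 - a$2) = (b$2 - a$2) * (c$1 - a$1)"
    using assms unfolding ort_def by simp
  have "\<exists>k. c - a = k *\<^sub>R (b - a)"
  proof (cases "b$1 = a$1")
    case True
    then have "b$2 \<noteq> a$2" using False by (simp add: vec2_eq_iff)
    then show ?thesis using eq True
      by (intro exI[of _ "(c$2 - a$2) / (b$2 - a$2)"]) (simp add: vec2_eq_iff)
  next
    case ne: False
    then show ?thesis using eq
      by (intro exI[of _ "(c$1 - a$1) / (b$1 - a$1)"]) (simp add: vec2_eq_iff nonzero_eq_divide_eq mult.commute)
  qed
  then have "collinear {0, b - a, c - a}"
    unfolding collinear_lemma by blast
  then have "collinear {b, a, c}"
    by (subst collinear_3) simp
  then show ?thesis by (simp add: insert_commute)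
qed simp

lemma collinear_imp_ort_0:
  assumes "collinear {a, b, c}" shows "ort a b c = 0"
proof -
  obtain u where u: "\<And>x y. x \<in> {a,b,c} \<Longrightarrow> y \<in> {a,b,c} \<Longrightarrow> \<exists>k. x - y = k *\<^sub>R u"
    using assms unfolding collinear_def by blast
  obtain k l where "b - a = k *\<^sub>R u" "c - a = l *\<^sub>R u" using u[of b a] u[of c a] by auto
  then have "b$i - a$i = k * u$i" "c$i - a$i = l * u$i" for i
    by (simp_all flip: vector_minus_component)
  then show ?thesis unfolding ort_def by (simp add: mult.commute)
qed

lemma general_position_ort:
  assumes "general_position S" "a \<in> S" "b \<in> S" "c \<in> S" "a \<noteq> b" "b \<noteq> c" "a \<noteq> c"
  shows "ort a b c \<noteq> 0"
proof
  assume "ort a b c = 0"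
  moreover have "card {a, b, c} = 3" using assms by simp
  ultimately show False
    using assms(1-4) ort_0_imp_collinear[of a b c] unfolding general_position_def by auto
qed

lemma general_position_subset:
  "general_position S \<Longrightarrow> A \<subseteq> S \<Longrightarrow> general_position A"
  unfolding general_position_def using finite_subset[of A S] subset_trans[of _ A S] by blast

lemma general_position_finite: "general_position S \<Longrightarrow> finite S"
  unfolding general_position_def by blast

text \<open>The factor \<open>e\<close>, in applications \<open>1\<close> or \<open>-1\<close>, makes every statement available together with its
mirror image.\<close>

lemma convex_ort_le: "convex {z. e * ort p q z \<le> 0}"
  and convex_ort_pos: "convex {z. 0 < e * ort p q z}"
proof -
  let ?v = "e *\<^sub>R (vector [p$2 - q$2, q$1 - p$1] :: real^2)"
  let ?c = "e * ((q$1 - p$1) * p$2 - (q$2 - p$2) * p$1)"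
  have eq: "e * ort p q z = ?v \<bullet> z - ?c" for z
    unfolding ort_inner by (simp add: algebra_simps)
  show "convex {z. e * ort p q z \<le> 0}"
    unfolding eq using convex_halfspace_le[of ?v ?c] by simp
  show "convex {z. 0 < e * ort p q z}"
    unfolding eq using convex_halfspace_gt[of ?c ?v] by simp
qed

text \<open>The only way in which disjointness of convex hulls is ever established: the line \<open>p q\<close> separates
the two sets, and may carry points of \<open>A\<close>.\<close>

lemma disjoint_hulls:
  assumes "\<And>x. x \<in> A \<Longrightarrow> e * ort p q x \<le> 0" "\<And>x. x \<in> B \<Longrightarrow> 0 < e * ort p q x"
  shows "convex hull A \<inter> convex hull B = {}"
proof -
  have "convex hull A \<subseteq> {z. e * ort p q z \<le> 0}"
    using assms(1) by (intro hull_minimal convex_ort_le) auto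
  moreover have "convex hull B \<subseteq> {z. 0 < e * ort p q z}"
    using assms(2) by (intro hull_minimal convex_ort_pos) auto
  ultimately show ?thesis by fastforce
qed

section \<open>Disjoint holes in separated sets\<close>

definition hole_free :: "(real^2) set \<Rightarrow> bool" where
  "hole_free A \<longleftrightarrow> (\<nexists>H. is_hole 5 A H)"

definition packs :: "nat \<Rightarrow> (real^2) set \<Rightarrow> bool" where
  "packs k S \<longleftrightarrow> (\<exists>\<H>. finite \<H> \<and> card \<H> = k \<and> disjoint_holes 5 S \<H>)"

lemma is_hole_Un:
  assumes "is_hole 5 A H" "convex hull A \<inter> convex hull B = {}"
  shows "is_hole 5 (A \<union> B) H"
proof -
  have "H \<subseteq> A" using assms(1) unfolding is_hole_def by blast
  then have "interior (convex hull H) \<subseteq> convex hull A"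
    using hull_mono interior_subset by (metis subset_trans)
  moreover have "B \<subseteq> convex hull B" by (rule hull_subset)
  ultimately have "interior (convex hull H) \<inter> B = {}" using assms(2) by blast
  then show ?thesis using assms(1) unfolding is_hole_def by blast
qed

text \<open>Sets with disjoint hulls do not disturb each other's holes, so the numbers of disjoint holes add
up. All lower bounds for larger sets are obtained by cutting with lines and adding up.\<close>

lemma packs_Un:
  assumes j: "packs j A" and k: "packs k B" and dis: "convex hull A \<inter> convex hull B = {}"
  shows "packs (j + k) (A \<union> B)"
proof -
  obtain \<F> where F: "finite \<F>" "card \<F> = j" "disjoint_holes 5 A \<F>"
    using j unfolding packs_def by blast
  obtain \<G> where G: "finite \<G>" "card \<G> = k" "disjoint_holes 5 B \<G>"
    using k unfolding packs_def by blast
  have Fh: "is_hole 5 A H" "convex hull H \<subseteq> convex hull A" "convex hull H \<noteq> {}" if "H \<in> \<F>" for H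
  proof -
    show h: "is_hole 5 A H" using F(3) that unfolding disjoint_holes_def by blast
    then show "convex hull H \<subseteq> convex hull A" unfolding is_hole_def by (meson hull_mono)
    show "convex hull H \<noteq> {}" using h unfolding is_hole_def by auto
  qed
  have Gh: "is_hole 5 B H" "convex hull H \<subseteq> convex hull B" if "H \<in> \<G>" for H
  proof -
    show h: "is_hole 5 B H" using G(3) that unfolding disjoint_holes_def by blast
    then show "convex hull H \<subseteq> convex hull B" unfolding is_hole_def by (meson hull_mono)
  qed
  have cross: "convex hull H \<inter> convex hull K = {}" if "H \<in> \<F>" "K \<in> \<G>" for H K
    using Fh(2)[OF that(1)] Gh(2)[OF that(2)] dis by blast
  have "\<F> \<inter> \<G> = {}" using cross Fh(3) by blast
  then have "card (\<F> \<union> \<G>) = j + k" using F G card_Un_disjoint by blast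
  moreover have "is_hole 5 (A \<union> B) H" if "H \<in> \<F> \<union> \<G>" for H
    using that is_hole_Un[OF Fh(1) dis] is_hole_Un[OF Gh(1), of H A] dis
    by (auto simp: Un_commute Int_commute)
  moreover have "disjoint_family_on (\<lambda>H. convex hull H) (\<F> \<union> \<G>)"
    using F(3) G(3) cross unfolding disjoint_holes_def disjoint_family_on_def by blast
  ultimately show ?thesis using F(1) G(1) unfolding packs_def disjoint_holes_def by blast
qed

lemma packs_0: "packs 0 S"
  unfolding packs_def disjoint_holes_def disjoint_family_on_def
  by (intro exI[of _ "{}"]) simp

lemma packs_1:
  assumes "\<not> hole_free A" shows "packs 1 A"
proof -
  obtain H where "is_hole 5 A H" using assms unfolding hole_free_def by blast
  then show ?thesis unfolding packs_def disjoint_holes_def disjoint_family_on_def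
    by (intro exI[of _ "{H}"]) simp
qed

lemma packs_Un_left:
  "packs j A \<Longrightarrow> convex hull A \<inter> convex hull B = {} \<Longrightarrow> packs j (A \<union> B)"
  using packs_Un[of j A 0 B] packs_0 by simp

section \<open>Empty convex pentagons\<close>

text \<open>Five points in counterclockwise order (clockwise if \<open>e\<close> is negative) are vertices of a convex
pentagon as soon as all ten triples are oriented alike, and its interior is the intersection of
five open half-planes.\<close>

lemma pentagon_is_hole:
  fixes a b c d f :: "real^2"
  assumes in_A: "a \<in> A" "b \<in> A" "c \<in> A" "d \<in> A" "f \<in> A"
    and abc: "0 < e * ort a b c" "0 < e * ort a b d" "0 < e * ort a b f"
    and acd: "0 < e * ort a c d" "0 < e * ort a c f" "0 < e * ort a d f"
    and bcd: "0 < e * ort b c d" "0 < e * ort b c f" "0 < e * ort b d f" "0 < e * ort c d f"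
    and empty: "\<And>x. x \<in> A \<Longrightarrow> x \<notin> {a,b,c,d,f} \<Longrightarrow> 0 < e * ort a b x \<Longrightarrow> 0 < e * ort b c x \<Longrightarrow>
       0 < e * ort c d x \<Longrightarrow> 0 < e * ort d f x \<Longrightarrow> 0 < e * ort f a x \<Longrightarrow> False"
  shows "is_hole 5 A {a,b,c,d,f}"
proof -
  let ?H = "{a,b,c,d,f}"
  note pos = abc acd bcd
  have dist: "a \<noteq> b" "a \<noteq> c" "a \<noteq> d" "a \<noteq> f" "b \<noteq> c" "b \<noteq> d" "b \<noteq> f" "c \<noteq> d" "c \<noteq> f" "d \<noteq> f"
    using pos by auto
  have e0: "e \<noteq> 0" using abc by auto
  have edge: "interior (convex hull ?H) \<subseteq> {z. 0 < e * ort p q z}"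
    if "p \<noteq> q" "\<forall>x\<in>?H. 0 \<le> e * ort p q x" for p q
  proof -
    define v where "v = e *\<^sub>R (vector [p$2 - q$2, q$1 - p$1] :: real^2)"
    define c' where "c' = e * ((q$1 - p$1) * p$2 - (q$2 - p$2) * p$1)"
    have eq: "e * ort p q z = v \<bullet> z - c'" for z
      unfolding ort_inner v_def c'_def by (simp add: algebra_simps)
    have "v \<noteq> 0" unfolding v_def using that(1) e0 by (auto simp: vec2_eq_iff)
    have "convex hull ?H \<subseteq> {z. v \<bullet> z \<ge> c'}"
      using that(2) unfolding eq by (intro hull_minimal convex_halfspace_ge) fastforce
    then have "interior (convex hull ?H) \<subseteq> interior {z. v \<bullet> z \<ge> c'}"
      by (rule interior_mono)
    also have "\<dots> = {z. v \<bullet> z > c'}" using \<open>v \<noteq> 0\<close> by (rule interior_halfspace_ge)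
    finally show ?thesis unfolding eq by auto
  qed
  have rot: "ort a c b = - ort a b c" "ort a d b = - ort a b d" "ort a f b = - ort a b f"
      "ort a d c = - ort a c d" "ort a f c = - ort a c f" "ort a f d = - ort a d f"
      "ort b c a = ort a b c" "ort b d a = ort a b d" "ort b f a = ort a b f"
      "ort b d c = - ort b c d" "ort b f c = - ort b c f" "ort b f d = - ort b d f"
      "ort c d a = ort a c d" "ort c d b = ort b c d" "ort c f a = ort a c f"
      "ort c f b = ort b c f" "ort c f d = - ort c d f"
      "ort d f a = ort a d f" "ort d f b = ort b d f" "ort d f c = ort c d f"
      "ort f a b = ort a b f" "ort f a c = ort a c f" "ort f a d = ort a d f"
      "ort f b a = - ort a b f" "ort f b c = ort b c f" "ort f b d = ort b d f"
    unfolding ort_def by (simp_all add: algebra_simps)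
  have rot': "ort b a c = - ort a b c" "ort b a d = - ort a b d" "ort b a f = - ort a b f"
      "ort c b d = - ort b c d" "ort c b f = - ort b c f" "ort c b a = - ort a b c"
      "ort d c f = - ort c d f" "ort d c a = - ort a c d" "ort d c b = - ort b c d"
      "ort c a b = ort a b c" "ort c a d = - ort a c d" "ort c a f = - ort a c f"
      "ort d b c = ort b c d" "ort d b a = - ort a b d" "ort d b f = - ort b d f"
      "ort f c d = ort c d f" "ort f c a = - ort a c f" "ort f c b = - ort b c f"
      "ort f d a = - ort a d f" "ort f d b = - ort b d f" "ort f d c = - ort c d f"
    unfolding ort_def by (simp_all add: algebra_simps)
  have "interior (convex hull ?H) \<subseteq> {z. 0 < e * ort a b z}"
    by (rule edge) (use dist pos in \<open>simp_all add: rot less_imp_le\<close>)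
  moreover have "interior (convex hull ?H) \<subseteq> {z. 0 < e * ort b c z}"
    by (rule edge) (use dist pos in \<open>simp_all add: rot less_imp_le\<close>)
  moreover have "interior (convex hull ?H) \<subseteq> {z. 0 < e * ort c d z}"
    by (rule edge) (use dist pos in \<open>simp_all add: rot less_imp_le\<close>)
  moreover have "interior (convex hull ?H) \<subseteq> {z. 0 < e * ort d f z}"
    by (rule edge) (use dist pos in \<open>simp_all add: rot less_imp_le\<close>)
  moreover have "interior (convex hull ?H) \<subseteq> {z. 0 < e * ort f a z}"
    by (rule edge) (use dist pos in \<open>simp_all add: rot less_imp_le\<close>)
  ultimately have int: "0 < e * ort a b z" "0 < e * ort b c z" "0 < e * ort c d z" "0 < e * ort d f z"
      "0 < e * ort f a z" if "z \<in> interior (convex hull ?H)" for z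
    using that by blast+
  have "interior (convex hull ?H) \<inter> A = {}"
  proof (rule ccontr)
    assume "interior (convex hull ?H) \<inter> A \<noteq> {}"
    then obtain x where x: "x \<in> interior (convex hull ?H)" "x \<in> A" by blast
    show False
    proof (cases "x \<in> ?H")
      case True
      then show ?thesis using int[OF x(1)] by auto
    next
      case False
      then show ?thesis using empty[OF x(2)] int[OF x(1)] by blast
    qed
  qed
  moreover have "{v. v extreme_point_of (convex hull ?H)} = ?H"
  proof -
    have sep: "v \<notin> convex hull (?H - {v})"
      if "\<forall>x\<in>?H. x \<noteq> v \<longrightarrow> e * ort p q x \<le> 0" "0 < e * ort p q v" for v p q
      using disjoint_hulls[of "?H - {v}" e p q "{v}"] that by auto
    have "a \<notin> convex hull (?H - {a})"
      by (rule sep[of _ b f]) (use dist pos in \<open>simp_all add: rot rot' less_imp_le\<close>)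
    moreover have "b \<notin> convex hull (?H - {b})"
      by (rule sep[of _ c a]) (use dist pos in \<open>simp_all add: rot rot' less_imp_le\<close>)
    moreover have "c \<notin> convex hull (?H - {c})"
      by (rule sep[of _ d b]) (use dist pos in \<open>simp_all add: rot rot' less_imp_le\<close>)
    moreover have "d \<notin> convex hull (?H - {d})"
      by (rule sep[of _ f c]) (use dist pos in \<open>simp_all add: rot rot' less_imp_le\<close>)
    moreover have "f \<notin> convex hull (?H - {f})"
      by (rule sep[of _ a d]) (use dist pos in \<open>simp_all add: rot rot' less_imp_le\<close>)
    ultimately have "v \<notin> convex hull (?H - {v})" if "v \<in> ?H" for v
      using that by blast
    then show ?thesis
      by (subst extreme_point_of_convex_hull_convex_independent) auto
  qed
  moreover have "card ?H = 5" using dist by simp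
  ultimately show ?thesis using in_A unfolding is_hole_def by blast
qed

section \<open>Pentagons among sorted points\<close>

lemma signotope_between:
  assumes "signotope n s" "i < j" "j < k" "k < l" "l < n"
  shows "between (s i j k) (s i j l) (s i k l) \<and> between (s i j k) (s i j l) (s j k l) \<and>
     between (s i j k) (s i k l) (s j k l) \<and> between (s i j l) (s i k l) (s j k l)"
  using assms unfolding signotope_def by blast

text \<open>The positions of a further point relative to five sorted ones. The negated inequalities
let the simplifier find the segment of a chain that spans \<open>x\<close>.\<close>

lemma position_cases:
  fixes x :: nat
  assumes ord: "a < b" "b < c" "c < d" "d < f" and x: "x \<notin> {a,b,c,d,f}"
  obtains "x < a" "x < b" "x < c" "x < d" "x < f"
  | "a < x" "b < x" "c < x" "d < x" "f < x"
  | "a < x" "x < b" "x < c" "x < d" "x < f" "\<not> x < a"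
  | "a < x" "b < x" "x < c" "x < d" "x < f" "\<not> x < a" "\<not> x < b"
  | "a < x" "b < x" "c < x" "x < d" "x < f" "\<not> x < a" "\<not> x < b" "\<not> x < c"
  | "a < x" "b < x" "c < x" "d < x" "x < f" "\<not> x < a" "\<not> x < b" "\<not> x < c"
      "\<not> x < d"
proof -
  have ne: "x \<noteq> a" "x \<noteq> b" "x \<noteq> c" "x \<noteq> d" "x \<noteq> f"
      using x by auto
  consider "x < a" | "a < x" "x < b" | "b < x" "x < c" | "c < x" "x < d" | "d < x" "x < f" | "f < x"
    using ne by linarith
  then show thesis
    by cases (use that ord in simp_all)
qed

lemma pentagon_contains_point:
  fixes p :: "nat \<Rightarrow> real^2" and e :: real
  assumes s_def: "\<And>i j k. s i j k \<longleftrightarrow> 0 < e * ort (p i) (p j) (p k)"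
    and free: "hole_free (p ` {..<n})"
    and in_n: "a < n" "b < n" "c < n" "d < n" "f < n"
    and pos: "s a b c" "s a b d" "s a b f" "s a c d" "s a c f"
        "s a d f"
      "s b c d" "s b c f" "s b d f" "s c d f"
  shows "\<exists>x<n. x \<notin> {a,b,c,d,f} \<and> s a b x \<and> s b c x \<and> s c d x \<and> s d f x \<and> s f a x"
proof -
  have "\<not> is_hole 5 (p ` {..<n}) {p a, p b, p c, p d, p f}"
    using free unfolding hole_free_def by blast
  then have "\<exists>y\<in>p ` {..<n}. y \<notin> {p a, p b, p c, p d, p f} \<and>
      0 < e * ort (p a) (p b) y \<and> 0 < e * ort (p b) (p c) y \<and> 0 < e * ort (p c) (p d) y \<and>
      0 < e * ort (p d) (p f) y \<and> 0 < e * ort (p f) (p a) y"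
    using pentagon_is_hole[of "p a" "p ` {..<n}" "p b" "p c" "p d" "p f" e] in_n pos
    unfolding s_def by blast
  then show ?thesis unfolding s_def by blast
qed

text \<open>Each of the eight blocks treats one distribution of the middle vertices over the two chains and
follows the same plan. The signotope axioms turn the three turns of the chains into the
orientations of all ten triples, so the five points form a convex pentagon. As it is no hole,
some point \<open>x\<close> is on the inner side of all five edges. If \<open>x\<close> came before \<open>a\<close>, all upper edges would
force \<open>x\<close> to be on one side of the line \<open>a f\<close> and all lower edges to be on the other; likewise after
\<open>f\<close>. Hence \<open>x\<close> is between \<open>a\<close> and \<open>f\<close>, and the edges that span it say that it is inside.\<close>

lemma pentagons_filled_if_hole_free:
  fixes p :: "nat \<Rightarrow> real^2" and e :: real
  assumes s_def: "\<And>i j k. s i j k \<longleftrightarrow> 0 < e * ort (p i) (p j) (p k)"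
    and e: "e \<noteq> 0" and gp: "general_position (p ` {..<n})" and inj: "inj_on p {..<n}"
    and sig: "signotope n s" and free: "hole_free (p ` {..<n})"
  shows "pentagons_filled n s"
proof -
  have cyc: "s j k i = s i j k" for i j k
    unfolding s_def by (simp add: ort_rotate)
  have swap: "s j i k = (\<not> s i j k)" if "i < n" "j < n" "k < n" "i \<noteq> j" "j \<noteq> k"
      "i \<noteq> k" for i j k
  proof -
    have "ort (p i) (p j) (p k) \<noteq> 0"
      using that inj by (intro general_position_ort[OF gp]) (auto simp: inj_on_eq_iff)
    then have "e * ort (p i) (p j) (p k) \<noteq> 0" using e by simp
    then show ?thesis unfolding s_def ort_swap(1)[of "p j" "p i"] mult_minus_right by linarith
  qed
  \<comment> \<open>Every orientation is brought to increasing indices.\<close>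
  have sort: "s j k i = s i j k" "s k i j = s i j k"
      "s j i k = (\<not> s i j k)" "s i k j = (\<not> s i j k)" "s k j i = (\<not> s i j k)"
    if "i < j" "j < k" "k < n" for i j k
  proof -
    have lt: "i < n" "i < k" using that by auto
    show "s j k i = s i j k" "s k i j = s i j k" using cyc[of j k i] cyc[of k i j] by blast+
    show ji: "s j i k = (\<not> s i j k)" using swap[of i j k] that lt by simp
    show "s i k j = (\<not> s i j k)" using ji cyc[of i k j] cyc[of k j i] by blast
    show "s k j i = (\<not> s i j k)" using ji cyc[of j i k] cyc[of i k j] cyc[of k j i] by blast
  qed
  have sg: "between (s i j k) (s i j l) (s i k l) \<and> between (s i j k) (s i j l) (s j k l) \<and>
     between (s i j k) (s i k l) (s j k l) \<and> between (s i j l) (s i k l) (s j k l)"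
    if "i < j" "j < k" "k < l" "l < n" for i j k l
    by (rule signotope_between[OF sig that])
  have left: "between (s x i j) (s x i k) (s x j k)" if "x < i" "i < j" "j < k" "k < n" for x i j k
    using sg[OF that] by blast
  have right: "between (s i j x) (s i k x) (s j k x)" if "i < j" "j < k" "k < x" "x < n" for x i j k
    using sg[OF that] by blast
  note point = pentagon_contains_point[OF s_def free]
  {
    fix a b c d f assume ord: "a < b" "b < c" "c < d" "d < f" "f < n"
    then have lt: "a < c" "a < d" "a < f" "b < d" "b < f" "c < f"
      "a < n" "b < n" "c < n" "d < n" by auto
    note q = sg[OF ord(1-3) lt(10)] sg[OF ord(1,2) lt(6) ord(5)] sg[OF ord(1) lt(4) ord(4,5)]
      sg[OF lt(1) ord(3-5)] sg[OF ord(2-5)]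
    have "filled s a [b,c,d] [] f"
      unfolding filled_def
    proof (intro impI)
      assume t: "turns s (a # [b,c,d] @ [f]) \<and> turns (\<lambda>i j k. \<not> s i j k) (a # [] @ [f])"
      have lits: "s a b c" "s a b d" "s a b f" "s a c d" "s a c f"
        "s a d f" "s b c d" "s b c f" "s b d f" "s c d f"
        using t q unfolding turns.simps append.simps between_def by sat+
      have "\<exists>x<n. x \<notin> {a,b,c,d,f} \<and> s a b x \<and> s b c x \<and> s c d x \<and> s d f x \<and> s f a x"
        by (rule point) (simp_all only:  lits ord lt simp_thms)
      then obtain x where x: "x < n" "x \<notin> {a,b,c,d,f}" "s a b x" "s b c x" "s c d x"
          "s d f x" "s f a x" by blast
      show "\<exists>x<f. a < x \<and> side (\<lambda>i j k. \<not> s i j k) (a # [b,c,d] @ [f]) x \<and> side s (a # [] @ [f]) x"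
      proof (rule position_cases[OF ord(1-4), of x])
        show "x \<notin> {a,b,c,d,f}" using x(2) by blast
      next
        assume o: "x < a" "x < b" "x < c" "x < d" "x < f"
        have "s x a b" "s x b c" "s x c d" "s x d f" "\<not> s x a f" using x(3-7)
            by (simp_all only: sort(1)[of x a b] sort(1)[of x b c] sort(1)[of x c d]
            sort(1)[of x d f] sort(5)[of x a f] ord lt o simp_thms)
        then have False using t left[OF o(1) ord(1) ord(2) lt(9)]
            left[OF o(1) lt(1) ord(3) lt(10)] left[OF o(1) lt(2) ord(4) ord(5)]
            unfolding turns.simps append.simps between_def by sat
        then show ?thesis ..
      next
        assume o: "a < x" "b < x" "c < x" "d < x" "f < x"
        have "s a b x" "s b c x" "s c d x" "s d f x" "\<not> s a f x" using x(3-7)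
            by (simp_all only: x(1) sort(3)[of a f x] ord lt o simp_thms)
        then have False using t right[OF ord(1) ord(2) o(3) x(1)]
            right[OF lt(1) ord(3) o(4) x(1)] right[OF lt(2) ord(4) o(5) x(1)]
            unfolding turns.simps append.simps between_def by sat
        then show ?thesis ..
      next
        assume o: "a < x" "x < b" "x < c" "x < d" "x < f" "\<not> x < a"
        have "\<not> s a x b" "s x b c" "s x c d" "s x d f" "s a x f" using x(3-7)
            by (simp_all only: x(1) sort(4)[of a x b] sort(1)[of x b c] sort(1)[of x c d]
            sort(1)[of x d f] sort(2)[of a x f] ord lt o simp_thms)
        then show ?thesis using x(2) o by (intro exI[of _ x]) simp
      next
        assume o: "a < x" "b < x" "x < c" "x < d" "x < f" "\<not> x < a" "\<not> x < b"
        have "s a b x" "\<not> s b x c" "s x c d" "s x d f" "s a x f" using x(3-7)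
            by (simp_all only: x(1) sort(4)[of b x c] sort(1)[of x c d] sort(1)[of x d f]
            sort(2)[of a x f] ord lt o simp_thms)
        then show ?thesis using x(2) o by (intro exI[of _ x]) simp
      next
        assume o: "a < x" "b < x" "c < x" "x < d" "x < f" "\<not> x < a" "\<not> x < b"
            "\<not> x < c"
        have "s a b x" "s b c x" "\<not> s c x d" "s x d f" "s a x f" using x(3-7)
            by (simp_all only: x(1) sort(4)[of c x d] sort(1)[of x d f] sort(2)[of a x f]
            ord lt o simp_thms)
        then show ?thesis using x(2) o by (intro exI[of _ x]) simp
      next
        assume o: "a < x" "b < x" "c < x" "d < x" "x < f" "\<not> x < a" "\<not> x < b"
            "\<not> x < c" "\<not> x < d"
        have "s a b x" "s b c x" "s c d x" "\<not> s d x f" "s a x f" using x(3-7)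
            by (simp_all only: x(1) sort(4)[of d x f] sort(2)[of a x f] ord lt o simp_thms)
        then show ?thesis using x(2) o by (intro exI[of _ x]) simp
      qed
    qed
    moreover
    have "filled s a [c,d] [b] f"
      unfolding filled_def
    proof (intro impI)
      assume t: "turns s (a # [c,d] @ [f]) \<and> turns (\<lambda>i j k. \<not> s i j k) (a # [b] @ [f])"
      have lits: "s a c d" "s a c f" "\<not> s a b c" "s a d f" "\<not> s a b d" "\<not> s a b f"
          "s c d f" "s b c d" "s b c f" "s b d f"
        using t q unfolding turns.simps append.simps between_def by sat+
      have "\<exists>x<n. x \<notin> {a,c,d,f,b} \<and> s a c x \<and> s c d x \<and> s d f x \<and> s f b x \<and> s b a x"
        by (rule point) (simp_all only: sort(4)[of a b c] sort(4)[of a b d] sort(4)[of a b f]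
            sort(1)[of b c d] sort(1)[of b c f] sort(1)[of b d f] lits ord lt simp_thms)
      then obtain x where x: "x < n" "x \<notin> {a,c,d,f,b}" "s a c x" "s c d x" "s d f x"
          "s f b x" "s b a x" by blast
      show "\<exists>x<f. a < x \<and> side (\<lambda>i j k. \<not> s i j k) (a # [c,d] @ [f]) x \<and> side s (a # [b] @ [f]) x"
      proof (rule position_cases[OF ord(1-4), of x])
        show "x \<notin> {a,b,c,d,f}" using x(2) by blast
      next
        assume o: "x < a" "x < b" "x < c" "x < d" "x < f"
        have "s x a c" "s x c d" "s x d f" "\<not> s x b f" "\<not> s x a b"
            using x(3-7) by (simp_all only: sort(1)[of x a c] sort(1)[of x c d]
            sort(1)[of x d f] sort(5)[of x b f] sort(5)[of x a b] ord lt o simp_thms)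
        then have False using t left[OF o(1) lt(1) ord(3) lt(10)]
            left[OF o(1) lt(2) ord(4) ord(5)] left[OF o(1) ord(1) lt(5) ord(5)]
            unfolding turns.simps append.simps between_def by sat
        then show ?thesis ..
      next
        assume o: "a < x" "b < x" "c < x" "d < x" "f < x"
        have "s a c x" "s c d x" "s d f x" "\<not> s b f x" "\<not> s a b x"
            using x(3-7) by (simp_all only: x(1) sort(3)[of b f x] sort(3)[of a b x]
            ord lt o simp_thms)
        then have False using t right[OF lt(1) ord(3) o(4) x(1)]
            right[OF lt(2) ord(4) o(5) x(1)] right[OF ord(1) lt(5) o(5) x(1)]
            unfolding turns.simps append.simps between_def by sat
        then show ?thesis ..
      next
        assume o: "a < x" "x < b" "x < c" "x < d" "x < f" "\<not> x < a"
        have "\<not> s a x c" "s x c d" "s x d f" "\<not> s x b f" "s a x b"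
            using x(3-7) by (simp_all only: x(1) sort(4)[of a x c] sort(1)[of x c d]
            sort(1)[of x d f] sort(5)[of x b f] sort(2)[of a x b] ord lt o simp_thms)
        then show ?thesis using x(2) o by (intro exI[of _ x]) simp
      next
        assume o: "a < x" "b < x" "x < c" "x < d" "x < f" "\<not> x < a" "\<not> x < b"
        have "\<not> s a x c" "s x c d" "s x d f" "s b x f" "\<not> s a b x"
            using x(3-7) by (simp_all only: x(1) sort(4)[of a x c] sort(1)[of x c d]
            sort(1)[of x d f] sort(2)[of b x f] sort(3)[of a b x] ord lt o simp_thms)
        then show ?thesis using x(2) o by (intro exI[of _ x]) simp
      next
        assume o: "a < x" "b < x" "c < x" "x < d" "x < f" "\<not> x < a" "\<not> x < b"
            "\<not> x < c"
        have "s a c x" "\<not> s c x d" "s x d f" "s b x f" "\<not> s a b x"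
            using x(3-7) by (simp_all only: x(1) sort(4)[of c x d] sort(1)[of x d f]
            sort(2)[of b x f] sort(3)[of a b x] ord lt o simp_thms)
        then show ?thesis using x(2) o by (intro exI[of _ x]) simp
      next
        assume o: "a < x" "b < x" "c < x" "d < x" "x < f" "\<not> x < a" "\<not> x < b"
            "\<not> x < c" "\<not> x < d"
        have "s a c x" "s c d x" "\<not> s d x f" "s b x f" "\<not> s a b x"
            using x(3-7) by (simp_all only: x(1) sort(4)[of d x f] sort(2)[of b x f]
            sort(3)[of a b x] ord lt o simp_thms)
        then show ?thesis using x(2) o by (intro exI[of _ x]) simp
      qed
    qed
    moreover
    have "filled s a [b,d] [c] f"
      unfolding filled_def
    proof (intro impI)
      assume t: "turns s (a # [b,d] @ [f]) \<and> turns (\<lambda>i j k. \<not> s i j k) (a # [c] @ [f])"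
      have lits: "s a b d" "s a b f" "s a b c" "s a d f" "\<not> s a c d" "\<not> s a c f"
          "s b d f" "\<not> s b c d" "\<not> s b c f" "s c d f"
        using t q unfolding turns.simps append.simps between_def by sat+
      have "\<exists>x<n. x \<notin> {a,b,d,f,c} \<and> s a b x \<and> s b d x \<and> s d f x \<and> s f c x \<and> s c a x"
        by (rule point) (simp_all only: sort(4)[of a c d] sort(4)[of a c f] sort(4)[of b c d]
            sort(4)[of b c f] sort(1)[of c d f] lits ord lt simp_thms)
      then obtain x where x: "x < n" "x \<notin> {a,b,d,f,c}" "s a b x" "s b d x" "s d f x"
          "s f c x" "s c a x" by blast
      show "\<exists>x<f. a < x \<and> side (\<lambda>i j k. \<not> s i j k) (a # [b,d] @ [f]) x \<and> side s (a # [c] @ [f]) x"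
      proof (rule position_cases[OF ord(1-4), of x])
        show "x \<notin> {a,b,c,d,f}" using x(2) by blast
      next
        assume o: "x < a" "x < b" "x < c" "x < d" "x < f"
        have "s x a b" "s x b d" "s x d f" "\<not> s x c f" "\<not> s x a c"
            using x(3-7) by (simp_all only: sort(1)[of x a b] sort(1)[of x b d]
            sort(1)[of x d f] sort(5)[of x c f] sort(5)[of x a c] ord lt o simp_thms)
        then have False using t left[OF o(1) ord(1) lt(4) lt(10)]
            left[OF o(1) lt(2) ord(4) ord(5)] left[OF o(1) lt(1) lt(6) ord(5)]
            unfolding turns.simps append.simps between_def by sat
        then show ?thesis ..
      next
        assume o: "a < x" "b < x" "c < x" "d < x" "f < x"
        have "s a b x" "s b d x" "s d f x" "\<not> s c f x" "\<not> s a c x"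
            using x(3-7) by (simp_all only: x(1) sort(3)[of c f x] sort(3)[of a c x]
            ord lt o simp_thms)
        then have False using t right[OF ord(1) lt(4) o(4) x(1)]
            right[OF lt(2) ord(4) o(5) x(1)] right[OF lt(1) lt(6) o(5) x(1)]
            unfolding turns.simps append.simps between_def by sat
        then show ?thesis ..
      next
        assume o: "a < x" "x < b" "x < c" "x < d" "x < f" "\<not> x < a"
        have "\<not> s a x b" "s x b d" "s x d f" "\<not> s x c f" "s a x c"
            using x(3-7) by (simp_all only: x(1) sort(4)[of a x b] sort(1)[of x b d]
            sort(1)[of x d f] sort(5)[of x c f] sort(2)[of a x c] ord lt o simp_thms)
        then show ?thesis using x(2) o by (intro exI[of _ x]) simp
      next
        assume o: "a < x" "b < x" "x < c" "x < d" "x < f" "\<not> x < a" "\<not> x < b"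
        have "s a b x" "\<not> s b x d" "s x d f" "\<not> s x c f" "s a x c"
            using x(3-7) by (simp_all only: x(1) sort(4)[of b x d] sort(1)[of x d f]
            sort(5)[of x c f] sort(2)[of a x c] ord lt o simp_thms)
        then show ?thesis using x(2) o by (intro exI[of _ x]) simp
      next
        assume o: "a < x" "b < x" "c < x" "x < d" "x < f" "\<not> x < a" "\<not> x < b"
            "\<not> x < c"
        have "s a b x" "\<not> s b x d" "s x d f" "s c x f" "\<not> s a c x"
            using x(3-7) by (simp_all only: x(1) sort(4)[of b x d] sort(1)[of x d f]
            sort(2)[of c x f] sort(3)[of a c x] ord lt o simp_thms)
        then show ?thesis using x(2) o by (intro exI[of _ x]) simp
      next
        assume o: "a < x" "b < x" "c < x" "d < x" "x < f" "\<not> x < a" "\<not> x < b"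
            "\<not> x < c" "\<not> x < d"
        have "s a b x" "s b d x" "\<not> s d x f" "s c x f" "\<not> s a c x"
            using x(3-7) by (simp_all only: x(1) sort(4)[of d x f] sort(2)[of c x f]
            sort(3)[of a c x] ord lt o simp_thms)
        then show ?thesis using x(2) o by (intro exI[of _ x]) simp
      qed
    qed
    moreover
    have "filled s a [b,c] [d] f"
      unfolding filled_def
    proof (intro impI)
      assume t: "turns s (a # [b,c] @ [f]) \<and> turns (\<lambda>i j k. \<not> s i j k) (a # [d] @ [f])"
      have lits: "s a b c" "s a b f" "s a b d" "s a c f" "s a c d" "\<not> s a d f" "s b c f"
          "s b c d" "\<not> s b d f" "\<not> s c d f"
        using t q unfolding turns.simps append.simps between_def by sat+
      have "\<exists>x<n. x \<notin> {a,b,c,f,d} \<and> s a b x \<and> s b c x \<and> s c f x \<and> s f d x \<and> s d a x"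
        by (rule point) (simp_all only: sort(4)[of a d f] sort(4)[of b d f]
            sort(4)[of c d f] lits ord lt simp_thms)
      then obtain x where x: "x < n" "x \<notin> {a,b,c,f,d}" "s a b x" "s b c x" "s c f x"
          "s f d x" "s d a x" by blast
      show "\<exists>x<f. a < x \<and> side (\<lambda>i j k. \<not> s i j k) (a # [b,c] @ [f]) x \<and> side s (a # [d] @ [f]) x"
      proof (rule position_cases[OF ord(1-4), of x])
        show "x \<notin> {a,b,c,d,f}" using x(2) by blast
      next
        assume o: "x < a" "x < b" "x < c" "x < d" "x < f"
        have "s x a b" "s x b c" "s x c f" "\<not> s x d f" "\<not> s x a d"
            using x(3-7) by (simp_all only: sort(1)[of x a b] sort(1)[of x b c]
            sort(1)[of x c f] sort(5)[of x d f] sort(5)[of x a d] ord lt o simp_thms)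
        then have False using t left[OF o(1) ord(1) ord(2) lt(9)]
            left[OF o(1) lt(1) lt(6) ord(5)] left[OF o(1) lt(2) ord(4) ord(5)]
            unfolding turns.simps append.simps between_def by sat
        then show ?thesis ..
      next
        assume o: "a < x" "b < x" "c < x" "d < x" "f < x"
        have "s a b x" "s b c x" "s c f x" "\<not> s d f x" "\<not> s a d x"
            using x(3-7) by (simp_all only: x(1) sort(3)[of d f x] sort(3)[of a d x]
            ord lt o simp_thms)
        then have False using t right[OF ord(1) ord(2) o(3) x(1)]
            right[OF lt(1) lt(6) o(5) x(1)] right[OF lt(2) ord(4) o(5) x(1)]
            unfolding turns.simps append.simps between_def by sat
        then show ?thesis ..
      next
        assume o: "a < x" "x < b" "x < c" "x < d" "x < f" "\<not> x < a"
        have "\<not> s a x b" "s x b c" "s x c f" "\<not> s x d f" "s a x d"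
            using x(3-7) by (simp_all only: x(1) sort(4)[of a x b] sort(1)[of x b c]
            sort(1)[of x c f] sort(5)[of x d f] sort(2)[of a x d] ord lt o simp_thms)
        then show ?thesis using x(2) o by (intro exI[of _ x]) simp
      next
        assume o: "a < x" "b < x" "x < c" "x < d" "x < f" "\<not> x < a" "\<not> x < b"
        have "s a b x" "\<not> s b x c" "s x c f" "\<not> s x d f" "s a x d"
            using x(3-7) by (simp_all only: x(1) sort(4)[of b x c] sort(1)[of x c f]
            sort(5)[of x d f] sort(2)[of a x d] ord lt o simp_thms)
        then show ?thesis using x(2) o by (intro exI[of _ x]) simp
      next
        assume o: "a < x" "b < x" "c < x" "x < d" "x < f" "\<not> x < a" "\<not> x < b"
            "\<not> x < c"
        have "s a b x" "s b c x" "\<not> s c x f" "\<not> s x d f" "s a x d"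
            using x(3-7) by (simp_all only: x(1) sort(4)[of c x f] sort(5)[of x d f]
            sort(2)[of a x d] ord lt o simp_thms)
        then show ?thesis using x(2) o by (intro exI[of _ x]) simp
      next
        assume o: "a < x" "b < x" "c < x" "d < x" "x < f" "\<not> x < a" "\<not> x < b"
            "\<not> x < c" "\<not> x < d"
        have "s a b x" "s b c x" "\<not> s c x f" "s d x f" "\<not> s a d x"
            using x(3-7) by (simp_all only: x(1) sort(4)[of c x f] sort(2)[of d x f]
            sort(3)[of a d x] ord lt o simp_thms)
        then show ?thesis using x(2) o by (intro exI[of _ x]) simp
      qed
    qed
    moreover
    have "filled s a [d] [b,c] f"
      unfolding filled_def
    proof (intro impI)
      assume t: "turns s (a # [d] @ [f]) \<and> turns (\<lambda>i j k. \<not> s i j k) (a # [b,c] @ [f])"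
      have lits: "s a d f" "\<not> s a c d" "\<not> s a b d" "\<not> s a c f" "\<not> s a b f"
          "\<not> s a b c" "s c d f" "s b d f" "\<not> s b c d" "\<not> s b c f"
        using t q unfolding turns.simps append.simps between_def by sat+
      have "\<exists>x<n. x \<notin> {a,d,f,c,b} \<and> s a d x \<and> s d f x \<and> s f c x \<and> s c b x \<and> s b a x"
        by (rule point) (simp_all only: sort(4)[of a c d] sort(4)[of a b d] sort(4)[of a c f]
            sort(4)[of a b f] sort(4)[of a b c] sort(1)[of c d f] sort(1)[of b d f]
            sort(5)[of b c d] sort(5)[of b c f] lits ord lt simp_thms)
      then obtain x where x: "x < n" "x \<notin> {a,d,f,c,b}" "s a d x" "s d f x" "s f c x"
          "s c b x" "s b a x" by blast
      show "\<exists>x<f. a < x \<and> side (\<lambda>i j k. \<not> s i j k) (a # [d] @ [f]) x \<and> side s (a # [b,c] @ [f]) x"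
      proof (rule position_cases[OF ord(1-4), of x])
        show "x \<notin> {a,b,c,d,f}" using x(2) by blast
      next
        assume o: "x < a" "x < b" "x < c" "x < d" "x < f"
        have "s x a d" "s x d f" "\<not> s x c f" "\<not> s x b c" "\<not> s x a b"
            using x(3-7) by (simp_all only: sort(1)[of x a d] sort(1)[of x d f]
            sort(5)[of x c f] sort(5)[of x b c] sort(5)[of x a b] ord lt o simp_thms)
        then have False using t left[OF o(1) lt(2) ord(4) ord(5)]
            left[OF o(1) ord(1) ord(2) lt(9)] left[OF o(1) lt(1) lt(6) ord(5)]
            unfolding turns.simps append.simps between_def by sat
        then show ?thesis ..
      next
        assume o: "a < x" "b < x" "c < x" "d < x" "f < x"
        have "s a d x" "s d f x" "\<not> s c f x" "\<not> s b c x" "\<not> s a b x"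
            using x(3-7) by (simp_all only: x(1) sort(3)[of c f x] sort(3)[of b c x]
            sort(3)[of a b x] ord lt o simp_thms)
        then have False using t right[OF lt(2) ord(4) o(5) x(1)]
            right[OF ord(1) ord(2) o(3) x(1)] right[OF lt(1) lt(6) o(5) x(1)]
            unfolding turns.simps append.simps between_def by sat
        then show ?thesis ..
      next
        assume o: "a < x" "x < b" "x < c" "x < d" "x < f" "\<not> x < a"
        have "\<not> s a x d" "s x d f" "\<not> s x c f" "\<not> s x b c" "s a x b"
            using x(3-7) by (simp_all only: x(1) sort(4)[of a x d] sort(1)[of x d f]
            sort(5)[of x c f] sort(5)[of x b c] sort(2)[of a x b] ord lt o simp_thms)
        then show ?thesis using x(2) o by (intro exI[of _ x]) simp
      next
        assume o: "a < x" "b < x" "x < c" "x < d" "x < f" "\<not> x < a" "\<not> x < b"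
        have "\<not> s a x d" "s x d f" "\<not> s x c f" "s b x c" "\<not> s a b x"
            using x(3-7) by (simp_all only: x(1) sort(4)[of a x d] sort(1)[of x d f]
            sort(5)[of x c f] sort(2)[of b x c] sort(3)[of a b x] ord lt o simp_thms)
        then show ?thesis using x(2) o by (intro exI[of _ x]) simp
      next
        assume o: "a < x" "b < x" "c < x" "x < d" "x < f" "\<not> x < a" "\<not> x < b"
            "\<not> x < c"
        have "\<not> s a x d" "s x d f" "s c x f" "\<not> s b c x" "\<not> s a b x"
            using x(3-7) by (simp_all only: x(1) sort(4)[of a x d] sort(1)[of x d f]
            sort(2)[of c x f] sort(3)[of b c x] sort(3)[of a b x] ord lt o simp_thms)
        then show ?thesis using x(2) o by (intro exI[of _ x]) simp
      next
        assume o: "a < x" "b < x" "c < x" "d < x" "x < f" "\<not> x < a" "\<not> x < b"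
            "\<not> x < c" "\<not> x < d"
        have "s a d x" "\<not> s d x f" "s c x f" "\<not> s b c x" "\<not> s a b x"
            using x(3-7) by (simp_all only: x(1) sort(4)[of d x f] sort(2)[of c x f]
            sort(3)[of b c x] sort(3)[of a b x] ord lt o simp_thms)
        then show ?thesis using x(2) o by (intro exI[of _ x]) simp
      qed
    qed
    moreover
    have "filled s a [c] [b,d] f"
      unfolding filled_def
    proof (intro impI)
      assume t: "turns s (a # [c] @ [f]) \<and> turns (\<lambda>i j k. \<not> s i j k) (a # [b,d] @ [f])"
      have lits: "s a c f" "s a c d" "\<not> s a b c" "\<not> s a d f" "\<not> s a b f"
          "\<not> s a b d" "\<not> s c d f" "s b c f" "s b c d" "\<not> s b d f"
        using t q unfolding turns.simps append.simps between_def by sat+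
      have "\<exists>x<n. x \<notin> {a,c,f,d,b} \<and> s a c x \<and> s c f x \<and> s f d x \<and> s d b x \<and> s b a x"
        by (rule point) (simp_all only: sort(4)[of a b c] sort(4)[of a d f] sort(4)[of a b f]
            sort(4)[of a b d] sort(4)[of c d f] sort(1)[of b c f] sort(1)[of b c d]
            sort(5)[of b d f] lits ord lt simp_thms)
      then obtain x where x: "x < n" "x \<notin> {a,c,f,d,b}" "s a c x" "s c f x" "s f d x"
          "s d b x" "s b a x" by blast
      show "\<exists>x<f. a < x \<and> side (\<lambda>i j k. \<not> s i j k) (a # [c] @ [f]) x \<and> side s (a # [b,d] @ [f]) x"
      proof (rule position_cases[OF ord(1-4), of x])
        show "x \<notin> {a,b,c,d,f}" using x(2) by blast
      next
        assume o: "x < a" "x < b" "x < c" "x < d" "x < f"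
        have "s x a c" "s x c f" "\<not> s x d f" "\<not> s x b d" "\<not> s x a b"
            using x(3-7) by (simp_all only: sort(1)[of x a c] sort(1)[of x c f]
            sort(5)[of x d f] sort(5)[of x b d] sort(5)[of x a b] ord lt o simp_thms)
        then have False using t left[OF o(1) lt(1) lt(6) ord(5)]
            left[OF o(1) ord(1) lt(4) lt(10)] left[OF o(1) lt(2) ord(4) ord(5)]
            unfolding turns.simps append.simps between_def by sat
        then show ?thesis ..
      next
        assume o: "a < x" "b < x" "c < x" "d < x" "f < x"
        have "s a c x" "s c f x" "\<not> s d f x" "\<not> s b d x" "\<not> s a b x"
            using x(3-7) by (simp_all only: x(1) sort(3)[of d f x] sort(3)[of b d x]
            sort(3)[of a b x] ord lt o simp_thms)
        then have False using t right[OF lt(1) lt(6) o(5) x(1)]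
            right[OF ord(1) lt(4) o(4) x(1)] right[OF lt(2) ord(4) o(5) x(1)]
            unfolding turns.simps append.simps between_def by sat
        then show ?thesis ..
      next
        assume o: "a < x" "x < b" "x < c" "x < d" "x < f" "\<not> x < a"
        have "\<not> s a x c" "s x c f" "\<not> s x d f" "\<not> s x b d" "s a x b"
            using x(3-7) by (simp_all only: x(1) sort(4)[of a x c] sort(1)[of x c f]
            sort(5)[of x d f] sort(5)[of x b d] sort(2)[of a x b] ord lt o simp_thms)
        then show ?thesis using x(2) o by (intro exI[of _ x]) simp
      next
        assume o: "a < x" "b < x" "x < c" "x < d" "x < f" "\<not> x < a" "\<not> x < b"
        have "\<not> s a x c" "s x c f" "\<not> s x d f" "s b x d" "\<not> s a b x"
            using x(3-7) by (simp_all only: x(1) sort(4)[of a x c] sort(1)[of x c f]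
            sort(5)[of x d f] sort(2)[of b x d] sort(3)[of a b x] ord lt o simp_thms)
        then show ?thesis using x(2) o by (intro exI[of _ x]) simp
      next
        assume o: "a < x" "b < x" "c < x" "x < d" "x < f" "\<not> x < a" "\<not> x < b"
            "\<not> x < c"
        have "s a c x" "\<not> s c x f" "\<not> s x d f" "s b x d" "\<not> s a b x"
            using x(3-7) by (simp_all only: x(1) sort(4)[of c x f] sort(5)[of x d f]
            sort(2)[of b x d] sort(3)[of a b x] ord lt o simp_thms)
        then show ?thesis using x(2) o by (intro exI[of _ x]) simp
      next
        assume o: "a < x" "b < x" "c < x" "d < x" "x < f" "\<not> x < a" "\<not> x < b"
            "\<not> x < c" "\<not> x < d"
        have "s a c x" "\<not> s c x f" "s d x f" "\<not> s b d x" "\<not> s a b x"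
            using x(3-7) by (simp_all only: x(1) sort(4)[of c x f] sort(2)[of d x f]
            sort(3)[of b d x] sort(3)[of a b x] ord lt o simp_thms)
        then show ?thesis using x(2) o by (intro exI[of _ x]) simp
      qed
    qed
    moreover
    have "filled s a [b] [c,d] f"
      unfolding filled_def
    proof (intro impI)
      assume t: "turns s (a # [b] @ [f]) \<and> turns (\<lambda>i j k. \<not> s i j k) (a # [c,d] @ [f])"
      have lits: "s a b f" "s a b d" "s a b c" "\<not> s a d f" "\<not> s a c f" "\<not> s a c d"
          "\<not> s b d f" "\<not> s b c f" "\<not> s b c d" "\<not> s c d f"
        using t q unfolding turns.simps append.simps between_def by sat+
      have "\<exists>x<n. x \<notin> {a,b,f,d,c} \<and> s a b x \<and> s b f x \<and> s f d x \<and> s d c x \<and> s c a x"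
        by (rule point) (simp_all only: sort(4)[of a d f] sort(4)[of a c f] sort(4)[of a c d]
            sort(4)[of b d f] sort(4)[of b c f] sort(4)[of b c d] sort(5)[of c d f]
            lits ord lt simp_thms)
      then obtain x where x: "x < n" "x \<notin> {a,b,f,d,c}" "s a b x" "s b f x" "s f d x"
          "s d c x" "s c a x" by blast
      show "\<exists>x<f. a < x \<and> side (\<lambda>i j k. \<not> s i j k) (a # [b] @ [f]) x \<and> side s (a # [c,d] @ [f]) x"
      proof (rule position_cases[OF ord(1-4), of x])
        show "x \<notin> {a,b,c,d,f}" using x(2) by blast
      next
        assume o: "x < a" "x < b" "x < c" "x < d" "x < f"
        have "s x a b" "s x b f" "\<not> s x d f" "\<not> s x c d" "\<not> s x a c"
            using x(3-7) by (simp_all only: sort(1)[of x a b] sort(1)[of x b f]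
            sort(5)[of x d f] sort(5)[of x c d] sort(5)[of x a c] ord lt o simp_thms)
        then have False using t left[OF o(1) ord(1) lt(5) ord(5)]
            left[OF o(1) lt(1) ord(3) lt(10)] left[OF o(1) lt(2) ord(4) ord(5)]
            unfolding turns.simps append.simps between_def by sat
        then show ?thesis ..
      next
        assume o: "a < x" "b < x" "c < x" "d < x" "f < x"
        have "s a b x" "s b f x" "\<not> s d f x" "\<not> s c d x" "\<not> s a c x"
            using x(3-7) by (simp_all only: x(1) sort(3)[of d f x] sort(3)[of c d x]
            sort(3)[of a c x] ord lt o simp_thms)
        then have False using t right[OF ord(1) lt(5) o(5) x(1)]
            right[OF lt(1) ord(3) o(4) x(1)] right[OF lt(2) ord(4) o(5) x(1)]
            unfolding turns.simps append.simps between_def by sat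
        then show ?thesis ..
      next
        assume o: "a < x" "x < b" "x < c" "x < d" "x < f" "\<not> x < a"
        have "\<not> s a x b" "s x b f" "\<not> s x d f" "\<not> s x c d" "s a x c"
            using x(3-7) by (simp_all only: x(1) sort(4)[of a x b] sort(1)[of x b f]
            sort(5)[of x d f] sort(5)[of x c d] sort(2)[of a x c] ord lt o simp_thms)
        then show ?thesis using x(2) o by (intro exI[of _ x]) simp
      next
        assume o: "a < x" "b < x" "x < c" "x < d" "x < f" "\<not> x < a" "\<not> x < b"
        have "s a b x" "\<not> s b x f" "\<not> s x d f" "\<not> s x c d" "s a x c"
            using x(3-7) by (simp_all only: x(1) sort(4)[of b x f] sort(5)[of x d f]
            sort(5)[of x c d] sort(2)[of a x c] ord lt o simp_thms)
        then show ?thesis using x(2) o by (intro exI[of _ x]) simp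
      next
        assume o: "a < x" "b < x" "c < x" "x < d" "x < f" "\<not> x < a" "\<not> x < b"
            "\<not> x < c"
        have "s a b x" "\<not> s b x f" "\<not> s x d f" "s c x d" "\<not> s a c x"
            using x(3-7) by (simp_all only: x(1) sort(4)[of b x f] sort(5)[of x d f]
            sort(2)[of c x d] sort(3)[of a c x] ord lt o simp_thms)
        then show ?thesis using x(2) o by (intro exI[of _ x]) simp
      next
        assume o: "a < x" "b < x" "c < x" "d < x" "x < f" "\<not> x < a" "\<not> x < b"
            "\<not> x < c" "\<not> x < d"
        have "s a b x" "\<not> s b x f" "s d x f" "\<not> s c d x" "\<not> s a c x"
            using x(3-7) by (simp_all only: x(1) sort(4)[of b x f] sort(2)[of d x f]
            sort(3)[of c d x] sort(3)[of a c x] ord lt o simp_thms)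
        then show ?thesis using x(2) o by (intro exI[of _ x]) simp
      qed
    qed
    moreover
    have "filled s a [] [b,c,d] f"
      unfolding filled_def
    proof (intro impI)
      assume t: "turns s (a # [] @ [f]) \<and> turns (\<lambda>i j k. \<not> s i j k) (a # [b,c,d] @ [f])"
      have lits: "\<not> s a d f" "\<not> s a c f" "\<not> s a b f" "\<not> s a c d"
          "\<not> s a b d" "\<not> s a b c" "\<not> s c d f" "\<not> s b d f" "\<not> s b c f"
          "\<not> s b c d"
        using t q unfolding turns.simps append.simps between_def by sat+
      have "\<exists>x<n. x \<notin> {a,f,d,c,b} \<and> s a f x \<and> s f d x \<and> s d c x \<and> s c b x \<and> s b a x"
        by (rule point) (simp_all only: sort(4)[of a d f] sort(4)[of a c f] sort(4)[of a b f]
            sort(4)[of a c d] sort(4)[of a b d] sort(4)[of a b c] sort(5)[of c d f]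
            sort(5)[of b d f] sort(5)[of b c f] sort(5)[of b c d] lits ord lt simp_thms)
      then obtain x where x: "x < n" "x \<notin> {a,f,d,c,b}" "s a f x" "s f d x" "s d c x"
          "s c b x" "s b a x" by blast
      show "\<exists>x<f. a < x \<and> side (\<lambda>i j k. \<not> s i j k) (a # [] @ [f]) x \<and> side s (a # [b,c,d] @ [f]) x"
      proof (rule position_cases[OF ord(1-4), of x])
        show "x \<notin> {a,b,c,d,f}" using x(2) by blast
      next
        assume o: "x < a" "x < b" "x < c" "x < d" "x < f"
        have "s x a f" "\<not> s x d f" "\<not> s x c d" "\<not> s x b c" "\<not> s x a b"
            using x(3-7) by (simp_all only: sort(1)[of x a f] sort(5)[of x d f]
            sort(5)[of x c d] sort(5)[of x b c] sort(5)[of x a b] ord lt o simp_thms)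
        then have False using t left[OF o(1) ord(1) ord(2) lt(9)]
            left[OF o(1) lt(1) ord(3) lt(10)] left[OF o(1) lt(2) ord(4) ord(5)]
            unfolding turns.simps append.simps between_def by sat
        then show ?thesis ..
      next
        assume o: "a < x" "b < x" "c < x" "d < x" "f < x"
        have "s a f x" "\<not> s d f x" "\<not> s c d x" "\<not> s b c x" "\<not> s a b x"
            using x(3-7) by (simp_all only: x(1) sort(3)[of d f x] sort(3)[of c d x]
            sort(3)[of b c x] sort(3)[of a b x] ord lt o simp_thms)
        then have False using t right[OF ord(1) ord(2) o(3) x(1)]
            right[OF lt(1) ord(3) o(4) x(1)] right[OF lt(2) ord(4) o(5) x(1)]
            unfolding turns.simps append.simps between_def by sat
        then show ?thesis ..
      next
        assume o: "a < x" "x < b" "x < c" "x < d" "x < f" "\<not> x < a"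
        have "\<not> s a x f" "\<not> s x d f" "\<not> s x c d" "\<not> s x b c" "s a x b"
            using x(3-7) by (simp_all only: x(1) sort(4)[of a x f] sort(5)[of x d f]
            sort(5)[of x c d] sort(5)[of x b c] sort(2)[of a x b] ord lt o simp_thms)
        then show ?thesis using x(2) o by (intro exI[of _ x]) simp
      next
        assume o: "a < x" "b < x" "x < c" "x < d" "x < f" "\<not> x < a" "\<not> x < b"
        have "\<not> s a x f" "\<not> s x d f" "\<not> s x c d" "s b x c" "\<not> s a b x"
            using x(3-7) by (simp_all only: x(1) sort(4)[of a x f] sort(5)[of x d f]
            sort(5)[of x c d] sort(2)[of b x c] sort(3)[of a b x] ord lt o simp_thms)
        then show ?thesis using x(2) o by (intro exI[of _ x]) simp
      next
        assume o: "a < x" "b < x" "c < x" "x < d" "x < f" "\<not> x < a" "\<not> x < b"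
            "\<not> x < c"
        have "\<not> s a x f" "\<not> s x d f" "s c x d" "\<not> s b c x" "\<not> s a b x"
            using x(3-7) by (simp_all only: x(1) sort(4)[of a x f] sort(5)[of x d f]
            sort(2)[of c x d] sort(3)[of b c x] sort(3)[of a b x] ord lt o simp_thms)
        then show ?thesis using x(2) o by (intro exI[of _ x]) simp
      next
        assume o: "a < x" "b < x" "c < x" "d < x" "x < f" "\<not> x < a" "\<not> x < b"
            "\<not> x < c" "\<not> x < d"
        have "\<not> s a x f" "s d x f" "\<not> s c d x" "\<not> s b c x" "\<not> s a b x"
            using x(3-7) by (simp_all only: x(1) sort(4)[of a x f] sort(2)[of d x f]
            sort(3)[of c d x] sort(3)[of b c x] sort(3)[of a b x] ord lt o simp_thms)
        then show ?thesis using x(2) o by (intro exI[of _ x]) simp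
      qed
    qed
    ultimately have "filled s a [b,c,d] [] f \<and> filled s a [c,d] [b] f \<and> filled s a [b,d] [c] f \<and>
     filled s a [b,c] [d] f \<and> filled s a [d] [b,c] f \<and> filled s a [c] [b,d] f \<and>
     filled s a [b] [c,d] f \<and> filled s a [] [b,c,d] f" by blast
  }
  then show ?thesis unfolding pentagons_filled_def by blast
qed

section \<open>Radial order\<close>

text \<open>Sorting by angle around \<open>apex\<close> is a linear order only if the other points fit into a half-plane.
Transitivity is the form in which this is needed.\<close>

definition radial :: "real \<Rightarrow> real^2 \<Rightarrow> (real^2) set \<Rightarrow> bool" where
  "radial e apex A \<longleftrightarrow> (\<forall>x\<in>A - {apex}. \<forall>y\<in>A - {apex}. \<forall>z\<in>A - {apex}.
     0 < e * ort apex x y \<longrightarrow> 0 < e * ort apex y z \<longrightarrow> 0 < e * ort apex x z)"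

lemma ort_trans:
  assumes t: "0 < e * ort apex t x" "0 < e * ort apex t y" "0 < e * ort apex t z"
    and xy: "0 < e * ort apex x y" and yz: "0 < e * ort apex y z"
  shows "0 < e * ort apex x z"
proof -
  have "(e * ort apex t y) * (e * ort apex x z) =
      (e * ort apex t x) * (e * ort apex y z) + (e * ort apex t z) * (e * ort apex x y)"
    using arg_cong[OF ort_pluecker[of apex t x y z], of "\<lambda>u. e * e * u"]
    by (simp add: algebra_simps)
  also have "\<dots> > 0"
    using add_pos_pos[OF mult_pos_pos[OF t(1) yz] mult_pos_pos[OF t(3) xy]] .
  finally show ?thesis using t(2) zero_less_mult_pos by blast
qed

text \<open>A hull edge \<open>apex t\<close> supplies the half-plane.\<close>

lemma radial_edge:
  assumes "\<And>z. z \<in> A \<Longrightarrow> z \<notin> {apex, t} \<Longrightarrow> 0 < e * ort apex t z"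
  shows "radial e apex A"
  unfolding radial_def
proof (intro ballI impI)
  fix x y z assume x: "x \<in> A - {apex}" and y: "y \<in> A - {apex}" and z: "z \<in> A - {apex}"
    and xy: "0 < e * ort apex x y" and yz: "0 < e * ort apex y z"
  have "y \<noteq> t"
  proof
    assume "y = t"
    then have "x \<noteq> t" using xy by auto
    then have "0 < e * ort apex t x" using assms x by blast
    then show False using xy \<open>y = t\<close> by (simp add: ort_def algebra_simps)
  qed
  have "z \<noteq> t"
  proof
    assume "z = t"
    have "0 < e * ort apex t y" using assms y \<open>y \<noteq> t\<close> by blast
    then show False using yz \<open>z = t\<close> by (simp add: ort_def algebra_simps)
  qed
  show "0 < e * ort apex x z"
  proof (cases "x = t")
    case True
    then show ?thesis using assms z \<open>z \<noteq> t\<close> by blast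
  next
    case False
    then show ?thesis using ort_trans[of e apex t x y z] assms x y z xy yz \<open>y \<noteq> t\<close> \<open>z \<noteq> t\<close> by blast
  qed
qed

lemma ort_trans_halfplane:
  assumes v: "0 < v \<bullet> (x - apex)" "0 < v \<bullet> (y - apex)" "0 < v \<bullet> (z - apex)"
    and xy: "0 < e * ort apex x y" and yz: "0 < e * ort apex y z"
  shows "0 < e * ort apex x z"
proof -
  have "(v \<bullet> (y - apex)) * ort apex x z = (v \<bullet> (z - apex)) * ort apex x y + (v \<bullet> (x - apex)) * ort apex y z"
    by (simp add: inner_vec_def sum_2 ort_def algebra_simps)
  then have "(v \<bullet> (y - apex)) * (e * ort apex x z) =
      (v \<bullet> (z - apex)) * (e * ort apex x y) + (v \<bullet> (x - apex)) * (e * ort apex y z)"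
    by (metis distrib_left mult.left_commute)
  also have "\<dots> > 0"
    using add_pos_pos[OF mult_pos_pos[OF v(3) xy] mult_pos_pos[OF v(1) yz]] .
  finally show ?thesis using v(2) zero_less_mult_pos by blast
qed

text \<open>A point of maximal norm is a hull vertex: all other points are in the open half-plane bounded by
the tangent to the circle through it.\<close>

lemma exists_apex:
  assumes "finite S" "S \<noteq> {}"
  shows "\<exists>apex\<in>S. radial e apex S"
proof -
  have "Max (norm ` S) \<in> norm ` S" using assms by (intro Max_in) auto
  then obtain p where p: "p \<in> S" "norm p = Max (norm ` S)" by auto
  have le: "norm z \<le> norm p" if "z \<in> S" for z
    unfolding p(2) using assms(1) that by (intro Max_ge) auto
  have "0 < (- p) \<bullet> (z - p)" if "z \<in> S" "z \<noteq> p" for z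
  proof -
    have "0 < (norm (z - p))\<^sup>2" using that by simp
    also have "\<dots> = (norm z)\<^sup>2 - (norm p)\<^sup>2 + 2 * ((- p) \<bullet> (z - p))"
      unfolding power2_norm_eq_inner by (simp add: inner_diff inner_commute algebra_simps)
    finally have "0 < (norm z)\<^sup>2 - (norm p)\<^sup>2 + 2 * ((- p) \<bullet> (z - p))" .
    moreover have "(norm z)\<^sup>2 \<le> (norm p)\<^sup>2"
      by (intro power_mono le that norm_ge_zero)
    ultimately show ?thesis by linarith
  qed
  then have "radial e p S"
    unfolding radial_def using ort_trans_halfplane[of "- p" _ p] by blast
  then show ?thesis using p(1) by blast
qed

lemma finite_sorted_list:
  assumes "finite B"
    and trans: "\<And>x y z. x \<in> B \<Longrightarrow> y \<in> B \<Longrightarrow> z \<in> B \<Longrightarrow> R x y \<Longrightarrow> R y z \<Longrightarrow> R x z"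
    and total: "\<And>x y. x \<in> B \<Longrightarrow> y \<in> B \<Longrightarrow> x \<noteq> y \<Longrightarrow> R x y \<or> R y x"
  shows "\<exists>xs. distinct xs \<and> set xs = B \<and> sorted_wrt R xs"
  using assms
proof (induction B rule: finite_induct)
  case (insert x B)
  have "\<exists>xs. distinct xs \<and> set xs = B \<and> sorted_wrt R xs"
    using insert.prems by (intro insert.IH) (meson insertCI)+
  then obtain xs where xs: "distinct xs" "set xs = B" "sorted_wrt R xs" by blast
  let ?l = "filter (\<lambda>y. R y x) xs" and ?r = "filter (\<lambda>y. \<not> R y x) xs"
  have r: "R x y" if "y \<in> set ?r" for y
    using that xs(2) insert.hyps(2) insert.prems(2)[of y x] by auto
  have "sorted_wrt R (?l @ x # ?r)"
    unfolding sorted_wrt_append using xs(2,3) r insert.prems(1) sorted_wrt_filter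
    by (auto 4 3)
  moreover have "distinct (?l @ x # ?r)" "set (?l @ x # ?r) = insert x B"
    using xs(1,2) insert.hyps(2) by auto
  ultimately show ?case by blast
qed simp

lemma radial_enumeration:
  assumes gp: "general_position A" and apex: "apex \<in> A" and rad: "radial e apex A" and e: "e \<noteq> 0"
  obtains p where "bij_betw p {..<card A} A" "p 0 = apex"
    "\<And>i j. 0 < i \<Longrightarrow> i < j \<Longrightarrow> j < card A \<Longrightarrow> 0 < e * ort (p 0) (p i) (p j)"
proof -
  let ?R = "\<lambda>x y. 0 < e * ort apex x y"
  have fin: "finite A" using gp by (rule general_position_finite)
  have total: "?R x y \<or> ?R y x" if "x \<in> A - {apex}" "y \<in> A - {apex}" "x \<noteq> y" for x y
  proof -
    have "ort apex x y \<noteq> 0" using that apex by (intro general_position_ort[OF gp]) auto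
    then have "e * ort apex x y \<noteq> 0" using e by simp
    then show ?thesis unfolding ort_swap(2)[of apex y x] mult_minus_right by linarith
  qed
  have "\<exists>xs. distinct xs \<and> set xs = A - {apex} \<and> sorted_wrt ?R xs"
  proof (rule finite_sorted_list)
    show "?R x z" if "x \<in> A - {apex}" "y \<in> A - {apex}" "z \<in> A - {apex}" "?R x y" "?R y z" for x y z
      using rad that unfolding radial_def by blast
  qed (use fin total in blast)+
  then obtain xs where xs: "distinct xs" "set xs = A - {apex}" "sorted_wrt ?R xs" by blast
  let ?p = "\<lambda>i. (apex # xs) ! i"
  have d: "distinct (apex # xs)" and s: "set (apex # xs) = A" using xs(1,2) apex by auto
  have len: "length (apex # xs) = card A" using distinct_card[OF d] s by simp
  have bij: "bij_betw ?p {..<card A} A"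
    by (rule bij_betw_nth[OF d]) (simp_all only: len s)
  have pos: "0 < e * ort (?p 0) (?p i) (?p j)" if "0 < i" "i < j" "j < card A" for i j
  proof -
    have "i - 1 < j - 1" "j - 1 < length xs" using that len by simp_all
    then have "0 < e * ort apex (xs ! (i - 1)) (xs ! (j - 1))" by (rule sorted_wrt_nth_less[OF xs(3)])
    then show ?thesis using that by (simp add: nth_Cons')
  qed
  show thesis by (rule that[OF bij _ pos]) simp_all
qed

lemma between_from_signs:
  fixes x y z :: real
  assumes "u * x - v * y + w * z = 0" "0 < u" "0 < v" "0 < w" "y \<noteq> 0"
  shows "between (0 < x) (0 < y) (0 < z)"
proof -
  have eq: "v * y = u * x + w * z" using assms(1) by simp
  show ?thesis unfolding between_def
  proof (intro conjI impI)
    assume "0 < x \<and> 0 < z"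
    then have "0 < v * y"
      unfolding eq using add_pos_pos[OF mult_pos_pos[OF assms(2)] mult_pos_pos[OF assms(4)]] by blast
    then show "0 < y" using assms(3) zero_less_mult_pos by blast
  next
    assume "0 < y"
    show "0 < x \<or> 0 < z"
    proof (rule ccontr)
      assume "\<not> ?thesis"
      then have "u * x \<le> 0" "w * z \<le> 0"
        using mult_nonneg_nonpos assms(2,4) by (simp_all add: mult_nonneg_nonpos)
      then have "v * y \<le> 0" unfolding eq by linarith
      then show False using mult_pos_pos[OF assms(3) \<open>0 < y\<close>] by linarith
    qed
  qed
qed

lemma ort_four_points:
  "ort apex a d * ort a b c - ort apex a c * ort a b d + ort apex a b * ort a c d = 0"
  "ort apex b d * ort a b c - ort apex b c * ort a b d + ort apex a b * ort b c d = 0"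
  "ort apex c d * ort a b c - ort apex b c * ort a c d + ort apex a c * ort b c d = 0"
  "ort apex c d * ort a b d - ort apex b d * ort a c d + ort apex a d * ort b c d = 0"
proof -
  have flip: "ort a apex x = - ort apex a x" "ort b apex x = - ort apex b x" "ort c apex x = - ort apex c x"
      "ort d apex x = - ort apex d x" "ort b a x = - ort a b x" "ort c b x = - ort b c x"
      "ort c a x = - ort a c x" for x
    by (rule ort_swap)+
  have swap: "ort apex b a = - ort apex a b" "ort apex c a = - ort apex a c" "ort apex c b = - ort apex b c"
      "ort apex d a = - ort apex a d" "ort apex d b = - ort apex b d" "ort apex d c = - ort apex c d"
      "ort a c b = - ort a b c" "ort d b c = ort b c d" "ort d a c = ort a c d" "ort d a b = ort a b d"
    by (rule ort_swap ort_rotate[symmetric])+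
  show "ort apex a d * ort a b c - ort apex a c * ort a b d + ort apex a b * ort a c d = 0"
    using ort_pluecker[of a apex b c d] unfolding flip by linarith
  show "ort apex b d * ort a b c - ort apex b c * ort a b d + ort apex a b * ort b c d = 0"
    using ort_pluecker[of b apex a c d] unfolding flip swap by linarith
  show "ort apex c d * ort a b c - ort apex b c * ort a c d + ort apex a c * ort b c d = 0"
    using ort_pluecker[of c apex a b d] unfolding flip swap by linarith
  show "ort apex c d * ort a b d - ort apex b d * ort a c d + ort apex a d * ort b c d = 0"
    using ort_pluecker[of d apex a b c] unfolding flip swap by linarith
qed

lemma scaled_sum_0:
  "u * x - v * y + w * z = 0 \<Longrightarrow> (e * u) * (e * x) - (e * v) * (e * y) + (e * w) * (e * z) = (0::real)"
  by algebra

text \<open>Four points sorted around \<open>p 0\<close> satisfy four linear relations whose coefficients are orientations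
of triples with \<open>p 0\<close>, hence positive; each relation excludes one pair of alternating patterns.\<close>

lemma signotope_radial:
  fixes p :: "nat \<Rightarrow> real^2" and e :: real
  assumes s_def: "\<And>i j k. s i j k \<longleftrightarrow> 0 < e * ort (p i) (p j) (p k)"
    and e: "e \<noteq> 0" and gp: "general_position (p ` {..<n})" and inj: "inj_on p {..<n}"
    and rad: "\<And>i j. 0 < i \<Longrightarrow> i < j \<Longrightarrow> j < n \<Longrightarrow> 0 < e * ort (p 0) (p i) (p j)"
  shows "signotope n s" and "rooted n s"
proof -
  show "rooted n s" unfolding rooted_def s_def using rad by blast
  show "signotope n s"
    unfolding signotope_def
  proof (intro allI impI)
    fix a b c d assume ord: "d < n" "c < d" "b < c" "a < b"
    show "between (s a b c) (s a b d) (s a c d) \<and> between (s a b c) (s a b d) (s b c d) \<and>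
     between (s a b c) (s a c d) (s b c d) \<and> between (s a b d) (s a c d) (s b c d)"
    proof (cases "a = 0")
      case True
      then have "s a b c" "s a b d" "s a c d" unfolding s_def using rad ord by auto
      then show ?thesis unfolding between_def by simp
    next
      case False
      let ?o = "\<lambda>i j k. e * ort (p i) (p j) (p k)"
      have pos: "0 < ?o 0 a b" "0 < ?o 0 a c" "0 < ?o 0 a d" "0 < ?o 0 b c" "0 < ?o 0 b d" "0 < ?o 0 c d"
        using rad False ord by auto
      have "ort (p a) (p b) (p d) \<noteq> 0" "ort (p a) (p c) (p d) \<noteq> 0"
        by (rule general_position_ort[OF gp]; use ord inj in \<open>auto simp: inj_on_eq_iff\<close>)+
      then have nz: "?o a b d \<noteq> 0" "?o a c d \<noteq> 0" using e by auto
      have sums: "?o 0 a d * ?o a b c - ?o 0 a c * ?o a b d + ?o 0 a b * ?o a c d = 0"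
        "?o 0 b d * ?o a b c - ?o 0 b c * ?o a b d + ?o 0 a b * ?o b c d = 0"
        "?o 0 c d * ?o a b c - ?o 0 b c * ?o a c d + ?o 0 a c * ?o b c d = 0"
        "?o 0 c d * ?o a b d - ?o 0 b d * ?o a c d + ?o 0 a d * ?o b c d = 0"
        by (intro scaled_sum_0 ort_four_points)+
      show ?thesis unfolding s_def
        using between_from_signs[OF sums(1) pos(3,2,1) nz(1)] between_from_signs[OF sums(2) pos(5,4,1) nz(1)]
          between_from_signs[OF sums(3) pos(6,4,2) nz(2)] between_from_signs[OF sums(4) pos(6,5,3) nz(2)]
        by (intro conjI)
    qed
  qed
qed

lemma signotope_compose:
  assumes "signotope m s" "\<And>i j. i < j \<Longrightarrow> j < n \<Longrightarrow> f i < f j" "\<And>i. i < n \<Longrightarrow> f i < m"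
  shows "signotope n (\<lambda>i j k. s (f i) (f j) (f k))"
  unfolding signotope_def
proof (intro allI impI)
  fix a b c d assume "d < n" "c < d" "b < c" "a < b"
  then show "between (s (f a) (f b) (f c)) (s (f a) (f b) (f d)) (s (f a) (f c) (f d)) \<and>
    between (s (f a) (f b) (f c)) (s (f a) (f b) (f d)) (s (f b) (f c) (f d)) \<and>
    between (s (f a) (f b) (f c)) (s (f a) (f c) (f d)) (s (f b) (f c) (f d)) \<and>
    between (s (f a) (f b) (f d)) (s (f a) (f c) (f d)) (s (f b) (f c) (f d))"
    using assms(2)[of a b] assms(2)[of b c] assms(2)[of c d] assms(3)[of d]
    by (intro signotope_between[OF assms(1)]) auto
qed

section \<open>Nine and ten points\<close>

lemma ten_points_not_hole_free:
  assumes gp: "general_position A" and card: "card A = 10"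
  shows "\<not> hole_free A"
proof
  assume free: "hole_free A"
  obtain apex where apex: "apex \<in> A" "radial 1 apex A"
    using exists_apex[of A 1] gp card general_position_finite by fastforce
  obtain p where p: "bij_betw p {..<card A} A" "p 0 = apex"
    "\<And>i j. 0 < i \<Longrightarrow> i < j \<Longrightarrow> j < card A \<Longrightarrow> 0 < 1 * ort (p 0) (p i) (p j)"
    using radial_enumeration[OF gp apex one_neq_zero] by blast
  have img: "p ` {..<10} = A" and inj: "inj_on p {..<10}"
    using p(1) card unfolding bij_betw_def by auto
  define s where "s i j k \<longleftrightarrow> 0 < 1 * ort (p i) (p j) (p k)" for i j k
  have sr: "signotope 10 s" "rooted 10 s"
    by (rule signotope_radial[OF s_def]; use gp img inj p(3) card in simp)+
  have "pentagons_filled 10 s"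
    by (rule pentagons_filled_if_hole_free[OF s_def]) (use gp img inj free sr in simp_all)
  then show False using ten_points_impossible sr by blast
qed

text \<open>The combinatorial statement, freed from the enumeration: \<open>t\<close> is the first and \<open>w\<close> the last point
around \<open>apex\<close>, and all remaining points are inside the triangle \<open>apex t w\<close>.\<close>

lemma nine_points_hull_triangle:
  assumes gp: "general_position A" and card: "card A = 9" and free: "hole_free A" and e: "e \<noteq> 0"
    and in_A: "apex \<in> A" "t \<in> A" "w \<in> A" "t \<noteq> apex" "w \<noteq> apex"
    and first: "\<And>z. z \<in> A \<Longrightarrow> z \<notin> {apex, t} \<Longrightarrow> 0 < e * ort apex t z"
    and last: "\<And>z. z \<in> A \<Longrightarrow> z \<notin> {apex, w} \<Longrightarrow> 0 < e * ort apex z w"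
    and z: "z \<in> A" "z \<notin> {apex, t, w}"
  shows "e * ort t z w < 0"
proof -
  obtain p where p: "bij_betw p {..<card A} A" "p 0 = apex"
    "\<And>i j. 0 < i \<Longrightarrow> i < j \<Longrightarrow> j < card A \<Longrightarrow> 0 < e * ort (p 0) (p i) (p j)"
    using radial_enumeration[OF gp in_A(1) radial_edge[OF first] e] by blast
  have img: "p ` {..<9} = A" and inj: "inj_on p {..<9}"
    using p(1) card unfolding bij_betw_def by auto
  define s where "s i j k \<longleftrightarrow> 0 < e * ort (p i) (p j) (p k)" for i j k
  have sr: "signotope 9 s" "rooted 9 s"
    by (rule signotope_radial[OF s_def e]; use gp img inj p(3) card in simp)+
  have "pentagons_filled 9 s"
    by (rule pentagons_filled_if_hole_free[OF s_def e]) (use gp img inj free sr in simp_all)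
  then have tri: "\<And>k. 1 < k \<Longrightarrow> k < 8 \<Longrightarrow> \<not> s 1 k 8" using nine_points_triangle sr by blast
  obtain i where i: "i < 9" "t = p i" using in_A(2) img by auto
  obtain j where j: "j < 9" "w = p j" using in_A(3) img by auto
  obtain k where k: "k < 9" "z = p k" using z(1) img by auto
  have "i \<noteq> 0" "j \<noteq> 0" "k \<noteq> 0"
    using i(2) j(2) k(2) in_A(4,5) z(2) p(2) by (metis insertI1)+
  have "i = 1"
  proof (rule ccontr)
    assume "i \<noteq> 1"
    then have "1 < i" using \<open>i \<noteq> 0\<close> by simp
    then have "p 1 \<noteq> t" "p 1 \<noteq> apex"
      using inj_on_eq_iff[OF inj, of 1 i] inj_on_eq_iff[OF inj, of 1 0] i p(2) by auto
    then have "0 < e * ort apex t (p 1)" using first img by auto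
    moreover have "0 < e * ort apex (p 1) t" using p(2) p(3)[of 1 i] \<open>1 < i\<close> i card by auto
    ultimately show False using ort_swap(2)[of apex t "p 1"] by simp
  qed
  have "j = 8"
  proof (rule ccontr)
    assume "j \<noteq> 8"
    then have "j < 8" using j(1) by simp
    then have "p 8 \<noteq> w" "p 8 \<noteq> apex"
      using inj_on_eq_iff[OF inj, of 8 j] inj_on_eq_iff[OF inj, of 8 0] j p(2) by auto
    then have "0 < e * ort apex (p 8) w" using last img by auto
    moreover have "0 < e * ort apex w (p 8)" using p(2) p(3)[of j 8] \<open>j < 8\<close> \<open>j \<noteq> 0\<close> j card by auto
    ultimately show False using ort_swap(2)[of apex w "p 8"] by simp
  qed
  have "k \<noteq> 1" "k \<noteq> 8" using z(2) i(2) j(2) k(2) \<open>i = 1\<close> \<open>j = 8\<close> by auto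
  then have "\<not> 0 < e * ort t z w"
    using tri[of k] k \<open>k \<noteq> 0\<close> i(2) j(2) \<open>i = 1\<close> \<open>j = 8\<close> unfolding s_def by auto
  moreover have "ort t z w \<noteq> 0"
  proof (rule general_position_ort[OF gp])
    show "t \<noteq> w" using inj_on_eq_iff[OF inj, of 1 8] i(2) j(2) \<open>i = 1\<close> \<open>j = 8\<close> by simp
  qed (use in_A z in auto)
  ultimately show ?thesis using e by (metis linorder_neqE_linordered_idom mult_eq_0_iff)
qed

text \<open>Cut along the line from a hull vertex to the point that comes last among the first \<open>m\<close> points
around it.\<close>

lemma split_off:
  assumes gp: "general_position S" and m: "2 \<le> m" "m \<le> card S"
  obtains A where "A \<subseteq> S" "card A = m" "convex hull A \<inter> convex hull (S - A) = {}"
proof -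
  have fin: "finite S" using gp by (rule general_position_finite)
  obtain apex where apex: "apex \<in> S" "radial 1 apex S"
    using exists_apex[of S 1] fin m by fastforce
  obtain p where p: "bij_betw p {..<card S} S" "p 0 = apex"
    "\<And>i j. 0 < i \<Longrightarrow> i < j \<Longrightarrow> j < card S \<Longrightarrow> 0 < 1 * ort (p 0) (p i) (p j)"
    using radial_enumeration[OF gp apex one_neq_zero] by blast
  have img: "p ` {..<card S} = S" and inj: "inj_on p {..<card S}"
    using p(1) unfolding bij_betw_def by auto
  let ?A = "p ` {..<m}"
  have "card ?A = m"
    using card_image[OF inj_on_subset[OF inj, of "{..<m}"]] m by auto
  moreover have "?A \<subseteq> S" using img m by auto
  moreover have "convex hull ?A \<inter> convex hull (S - ?A) = {}"
  proof (rule disjoint_hulls[where e = 1 and p = "p 0" and q = "p (m - 1)"])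
    fix x assume "x \<in> ?A"
    then obtain i where i: "i < m" "x = p i" by auto
    show "1 * ort (p 0) (p (m - 1)) x \<le> 0"
    proof (cases "i = 0 \<or> i = m - 1")
      case False
      then have "0 < 1 * ort (p 0) (p i) (p (m - 1))" using p(3)[of i "m - 1"] i m by auto
      then show ?thesis unfolding i(2) ort_swap(2)[of "p 0" "p (m - 1)"] by simp
    qed (use i in auto)
  next
    fix x assume "x \<in> S - ?A"
    then obtain i where i: "i < card S" "x = p i" using img by auto
    then have "\<not> i < m" using \<open>x \<in> S - ?A\<close> by auto
    then show "0 < 1 * ort (p 0) (p (m - 1)) x" using p(3)[of "m - 1" i] m i by auto
  qed
  ultimately show thesis by (intro that)
qed

section \<open>Points that come first around both ends of a hull edge\<close>

lemma frac_le_cross: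
  "a / b \<le> c / d \<Longrightarrow> 0 < b \<Longrightarrow> 0 < d \<Longrightarrow> a * d \<le> c * (b :: real)"
  by (simp add: field_simps)

text \<open>Two sets separated by a line have an inner common tangent \<open>p y\<close>. Measure points by their
distance \<open>f\<close> from the separating line and their position \<open>g\<close> along it: among all segments from \<open>P\<close>
to \<open>Y\<close>, the one with minimal slope \<open>\<rho>\<close> is tangent to both sets.\<close>

lemma inner_bitangent:
  assumes gp: "general_position (P \<union> Y)" and disj: "P \<inter> Y = {}" and ne: "P \<noteq> {}" "Y \<noteq> {}" and e: "e \<noteq> 0"
    and cut: "\<And>p. p \<in> P \<Longrightarrow> e * ort s r p \<le> 0" "\<And>y. y \<in> Y \<Longrightarrow> 0 < e * ort s r y"
  obtains p y where "p \<in> P" "y \<in> Y" "\<And>q. q \<in> P - {p} \<Longrightarrow> 0 < e * ort p y q"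
    "\<And>z. z \<in> Y - {y} \<Longrightarrow> e * ort p y z < 0"
proof -
  define f :: "real^2 \<Rightarrow> real" where "f z = e * ort s r z" for z
  define g :: "real^2 \<Rightarrow> real" where "g z = (r$1 - s$1) * z$1 + (r$2 - s$2) * z$2" for z
  define N where "N = (r$1 - s$1)\<^sup>2 + (r$2 - s$2)\<^sup>2"
  define \<rho> where "\<rho> = (\<lambda>(p, y). (g y - g p) / (f y - f p))"
  have fpos: "0 < f y - f p" if "p \<in> P" "y \<in> Y" for p y
    using cut(1)[OF that(1)] cut(2)[OF that(2)] unfolding f_def by linarith
  have "r \<noteq> s" using cut(2) ne(2) by auto
  then have "N > 0" unfolding N_def using vec2_eq_iff[of r s]
    by (metis add_pos_nonneg add_nonneg_pos less_eq_real_def right_minus_eq zero_eq_power2 zero_le_power2)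
  \<comment> \<open>The slopes of two segments compare like the sign of the cross product of their directions.\<close>
  have cross: "(f y - f p) * (g y' - g p') - (f y' - f p') * (g y - g p) =
      e * N * ((y'$1 - p'$1) * (y$2 - p$2) - (y'$2 - p'$2) * (y$1 - p$1))" for p y p' y' :: "real^2"
    unfolding f_def g_def N_def ort_def power2_eq_square by (simp add: algebra_simps)
  have fin: "finite (P \<times> Y)" "P \<times> Y \<noteq> {}"
    using general_position_finite[OF gp] ne by auto
  then obtain m where m: "m \<in> P \<times> Y" "\<And>x. x \<in> P \<times> Y \<Longrightarrow> \<rho> m \<le> \<rho> x"
    using ex_is_arg_min_if_finite[OF fin, of \<rho>] unfolding is_arg_min_linorder by blast
  obtain p y where py: "m = (p, y)" "p \<in> P" "y \<in> Y" using m(1) by auto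
  have min: "0 \<le> e * ((y'$1 - p'$1) * (y$2 - p$2) - (y'$2 - p'$2) * (y$1 - p$1))"
    if "p' \<in> P" "y' \<in> Y" for p' y'
  proof -
    have "\<rho> (p, y) \<le> \<rho> (p', y')" using m(2)[of "(p', y')"] that py(1) by simp
    then have "(g y - g p) * (f y' - f p') \<le> (g y' - g p') * (f y - f p)"
      unfolding \<rho>_def using frac_le_cross fpos[OF py(2,3)] fpos[OF that] by auto
    then have "0 \<le> N * (e * ((y'$1 - p'$1) * (y$2 - p$2) - (y'$2 - p'$2) * (y$1 - p$1)))"
      using cross[of y p y' p'] by (simp add: algebra_simps)
    then show ?thesis using \<open>N > 0\<close> by (simp add: zero_le_mult_iff)
  qed
  have nz: "e * ort p y z \<noteq> 0" if "z \<in> P \<union> Y" "z \<noteq> p" "z \<noteq> y" for z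
    using general_position_ort[OF gp, of p y z] that py disj e by auto
  show thesis
  proof (rule that[OF py(2,3)])
    fix q assume q: "q \<in> P - {p}"
    have "0 \<le> e * ort p y q"
      using min[of q y] q py by (simp add: ort_def algebra_simps)
    moreover have "e * ort p y q \<noteq> 0" by (rule nz) (use q py disj in auto)
    ultimately show "0 < e * ort p y q" by linarith
  next
    fix z assume z: "z \<in> Y - {y}"
    have "0 \<le> - (e * ort p y z)"
      using min[of p z] z py by (simp add: ort_def algebra_simps)
    moreover have "e * ort p y z \<noteq> 0" by (rule nz) (use z py disj in auto)
    ultimately show "e * ort p y z < 0" by linarith
  qed
qed

text \<open>The key step. Let \<open>s t\<close> be a hull edge and let \<open>P\<close> consist of \<open>s\<close> and the seven points that come
first around \<open>s\<close>, with \<open>r\<close> the last of them. Then \<open>P\<close> also comes first around \<open>t\<close>.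

One inner common tangent of \<open>P\<close> and \<open>Y\<close> passes through \<open>s\<close>. The other one touches \<open>P\<close> in \<open>p\<close> and
\<open>Y\<close> in \<open>y\<close>. The nine points \<open>insert y P\<close> are cut off from the rest of \<open>Y\<close> by this tangent, so they
are hole-free and their hull is the triangle \<open>s t y\<close>. As \<open>p\<close> is a vertex of this hull, different
from \<open>y\<close> and, by orientation, from \<open>s\<close>, it is \<open>t\<close>. So the tangent through \<open>t\<close> separates \<open>P\<close> from
\<open>Y\<close>, which is the claim.\<close>

lemma core:
  assumes gp: "general_position (P \<union> Y)" and disj: "P \<inter> Y = {}" and card: "card P = 8" and e: "e \<noteq> 0"
    and st: "s \<in> P" "t \<in> P" "s \<noteq> t" and r: "r \<in> P"
    and edge: "\<And>z. z \<in> P \<union> Y \<Longrightarrow> z \<notin> {s, t} \<Longrightarrow> 0 < e * ort s t z"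
    and cut: "\<And>p. p \<in> P \<Longrightarrow> e * ort s r p \<le> 0" "\<And>y. y \<in> Y \<Longrightarrow> 0 < e * ort s r y"
    and free: "\<And>y. y \<in> Y \<Longrightarrow> convex hull (insert y P) \<inter> convex hull (Y - {y}) = {} \<Longrightarrow>
       hole_free (insert y P)"
    and q: "q \<in> P - {t}" and z: "z \<in> Y"
  shows "e * ort t q z < 0"
proof -
  have swap: "e * ort b a c = - (e * ort a b c)" "e * ort a c b = - (e * ort a b c)" for a b c
    using ort_swap[of b a c] ort_swap[of a c b] by simp_all
  obtain p y where p: "p \<in> P" and y: "y \<in> Y" and Pside: "\<And>q. q \<in> P - {p} \<Longrightarrow> 0 < e * ort p y q"
    and Yside: "\<And>z. z \<in> Y - {y} \<Longrightarrow> e * ort p y z < 0"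
    using inner_bitangent[OF gp disj _ _ e cut] st z by blast
  let ?A = "insert y P"
  have gpA: "general_position ?A" using general_position_subset[OF gp] y by auto
  have ynP: "y \<notin> P" using y disj by auto
  have "finite P" using card by (simp add: card_ge_0_finite)
  then have cardA: "card ?A = 9" using card ynP by simp
  have "convex hull ?A \<inter> convex hull (Y - {y}) = {}"
  proof (rule disjoint_hulls[where e = "- e" and p = p and q = y])
    fix x assume "x \<in> ?A"
    then show "- e * ort p y x \<le> 0" using Pside[of x] by (cases "x = p \<or> x = y") auto
  next
    fix x assume "x \<in> Y - {y}"
    then show "0 < - e * ort p y x" using Yside[of x] by simp
  qed
  then have freeA: "hole_free ?A" using free y by blast
  \<comment> \<open>Around s, the point y comes after all of P, because it comes after r.\<close>
  have last: "0 < e * ort s x y" if "x \<in> ?A" "x \<notin> {s, y}" for x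
  proof (cases "x = t")
    case True
    then show ?thesis using edge[of y] y ynP st by auto
  next
    case False
    have "r \<noteq> s" using cut(2)[OF y] by auto
    have "r \<noteq> t"
    proof
      assume "r = t"
      then show False using cut(1)[of x] edge[of x] that False by auto
    qed
    have ry: "0 < e * ort s r y" by (rule cut(2)[OF y])
    have tr: "0 < e * ort s t r" "0 < e * ort s t x" "0 < e * ort s t y"
      using edge r that False \<open>r \<noteq> s\<close> \<open>r \<noteq> t\<close> y ynP st by auto
    show ?thesis
    proof (cases "x = r")
      case False
      have "e * ort s r x \<le> 0" using cut(1) that by auto
      moreover have "ort s r x \<noteq> 0"
        using that r st False \<open>r \<noteq> s\<close> by (intro general_position_ort[OF gpA]) auto
      ultimately have "0 < e * ort s x r" using swap(2)[of s x r] e by (auto simp: less_le)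
      then show ?thesis using ort_trans[OF tr(2,1,3) _ ry] by blast
    qed (use ry in simp)
  qed
  have tri: "e * ort t x y < 0" if "x \<in> ?A" "x \<notin> {s, t, y}" for x
    by (rule nine_points_hull_triangle[OF gpA cardA freeA e, of s])
      (use st that edge last y ynP in auto)
  have "p = s \<or> p = t"
  proof (rule ccontr)
    \<comment> \<open>Otherwise p is strictly inside the triangle, so its vertices cannot all be on one side of a line through p.\<close>
    assume ps: "\<not> (p = s \<or> p = t)"
    have "0 < e * ort s t p" using edge p ps by auto
    moreover have "0 < e * ort t y p" using tri[of p] p ps ynP swap(2)[of t p y] by auto
    moreover have "0 < e * ort y s p" using last[of p] p ps ynP swap(2)[of s p y] swap(1)[of y s p] by auto
    moreover have "0 < e * ort p y s" "0 < e * ort p y t" using Pside ps st by auto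
    moreover have "(e * ort t y p) * (e * ort p y s) + (e * ort y s p) * (e * ort p y t)
        + (e * ort s t p) * (e * ort p y y) = 0"
      using arg_cong[OF ort_barycentric[of t y p y s], of "\<lambda>u. e * e * u"] by (simp add: algebra_simps)
    ultimately show False
      using add_pos_pos[OF mult_pos_pos[of "e * ort t y p" "e * ort p y s"] mult_pos_pos[of "e * ort y s p" "e * ort p y t"]]
      by simp
  qed
  moreover have "p \<noteq> s"
  proof
    assume "p = s"
    then have "0 < e * ort s y t" using Pside[of t] st by auto
    moreover have "0 < e * ort s t y" using edge[of y] y ynP st by auto
    ultimately show False using swap(2)[of s y t] by simp
  qed
  ultimately have [simp]: "p = t" by blast
  have qy: "0 < e * ort t y q" using Pside[of q] q by simp
  show ?thesis
  proof (cases "z = y")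
    case True
    then show ?thesis using qy swap(2)[of t q y] by simp
  next
    case False
    have yz: "e * ort t y z < 0" using Yside[of z] z False by simp
    have znP: "z \<notin> P" using z disj by auto
    have rev_edge: "0 < - e * ort t s x" if "x \<in> P \<union> Y" "x \<notin> {s, t}" for x
      using edge[OF that] swap(1)[of t s x] by simp
    show ?thesis
    proof (cases "q = s")
      case True
      then show ?thesis using rev_edge[of z] z znP st by auto
    next
      case False
      have "0 < - e * ort t q z"
      proof (rule ort_trans[of "- e" t s q y z])
        show "0 < - e * ort t s q" "0 < - e * ort t s y" "0 < - e * ort t s z"
          using rev_edge q False y ynP z znP st by auto
        show "0 < - e * ort t q y" using qy swap(2)[of t q y] by simp
        show "0 < - e * ort t y z" using yz by simp
      qed
      then show ?thesis by simp
    qed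
  qed
qed

section \<open>Nineteen points\<close>

definition hull_edge :: "(real^2) set \<Rightarrow> real^2 \<Rightarrow> real^2 \<Rightarrow> bool" where
  "hull_edge S a b \<longleftrightarrow> a \<in> S \<and> b \<in> S \<and> a \<noteq> b \<and> (\<forall>z\<in>S - {a, b}. 0 < ort a b z)"

text \<open>The core of a hull edge consists of six points that precede all other points both in the order
around \<open>a\<close> and in the order around \<open>b\<close>; it lies in every triangle \<open>a b y\<close>.\<close>

definition edge_core :: "(real^2) set \<Rightarrow> real^2 \<Rightarrow> real^2 \<Rightarrow> (real^2) set \<Rightarrow> bool" where
  "edge_core S a b K \<longleftrightarrow> K \<subseteq> S - {a, b} \<and> card K = 6 \<and>
     (\<forall>k\<in>K. \<forall>y\<in>S - K - {a, b}. 0 < ort a k y \<and> ort b k y < 0)"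

lemma exists_hull_edge:
  assumes gp: "general_position S" and card: "2 \<le> card S"
  obtains a b where "hull_edge S a b"
proof -
  obtain apex where apex: "apex \<in> S" "radial 1 apex S"
    using exists_apex[of S 1] general_position_finite[OF gp] card by fastforce
  obtain p where p: "bij_betw p {..<card S} S" "p 0 = apex"
    "\<And>i j. 0 < i \<Longrightarrow> i < j \<Longrightarrow> j < card S \<Longrightarrow> 0 < 1 * ort (p 0) (p i) (p j)"
    using radial_enumeration[OF gp apex one_neq_zero] by blast
  have img: "p ` {..<card S} = S" and inj: "inj_on p {..<card S}"
    using p(1) unfolding bij_betw_def by auto
  have "hull_edge S (p 0) (p 1)"
    unfolding hull_edge_def
  proof (intro conjI ballI)
    show "p 0 \<in> S" "p 1 \<in> S" using img card by auto
    show "p 0 \<noteq> p 1" using inj_on_eq_iff[OF inj, of 0 1] card by simp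
    fix z assume z: "z \<in> S - {p 0, p 1}"
    then obtain i where i: "i < card S" "z = p i" using img by auto
    then have "i \<noteq> 0" "i \<noteq> 1" using z by (metis DiffE insertCI)+
    then show "0 < ort (p 0) (p 1) z" using p(3)[of 1 i] i by simp
  qed
  then show thesis by (rule that)
qed

text \<open>The next edge leads to the last point in the clockwise order around \<open>b\<close> that starts with \<open>a\<close>.\<close>

lemma next_hull_edge:
  assumes gp: "general_position S" and card: "3 \<le> card S" and ab: "hull_edge S a b"
  obtains c where "hull_edge S b c" "c \<noteq> a"
proof -
  have in_S: "a \<in> S" "b \<in> S" "a \<noteq> b" and left: "\<And>z. z \<in> S \<Longrightarrow> z \<notin> {a, b} \<Longrightarrow> 0 < ort a b z"
    using ab unfolding hull_edge_def by auto
  have rad: "radial (-1) b S"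
    using left ort_swap(1)[of b a] by (intro radial_edge[of _ b a]) auto
  have "(-1::real) \<noteq> 0" by simp
  then obtain p where p: "bij_betw p {..<card S} S" "p 0 = b"
    "\<And>i j. 0 < i \<Longrightarrow> i < j \<Longrightarrow> j < card S \<Longrightarrow> 0 < (-1) * ort (p 0) (p i) (p j)"
    using radial_enumeration[OF gp in_S(2) rad] by blast
  have img: "p ` {..<card S} = S" and inj: "inj_on p {..<card S}"
    using p(1) unfolding bij_betw_def by auto
  let ?c = "p (card S - 1)"
  have "?c \<in> S" using img card by auto
  moreover have "b \<noteq> ?c" using inj_on_eq_iff[OF inj, of 0 "card S - 1"] card p(2) by auto
  moreover have right: "0 < ort b ?c z" if z: "z \<in> S - {b, ?c}" for z
  proof -
    obtain i where i: "i < card S" "z = p i" using img z by auto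
    then have "i \<noteq> 0" "i \<noteq> card S - 1" using z p(2) by (metis DiffE insertCI)+
    then show ?thesis
      using p(3)[of i "card S - 1"] i ort_swap(2)[of b ?c z] p(2) by simp
  qed
  ultimately have "hull_edge S b ?c" using in_S unfolding hull_edge_def by blast
  moreover have "?c \<noteq> a"
  proof
    assume c: "?c = a"
    have "card {a, b} = 2" using in_S by simp
    then have "\<not> S \<subseteq> {a, b}" using card card_mono[of "{a, b}" S] by auto
    then obtain z where "z \<in> S" "z \<notin> {a, b}" by blast
    then show False using left[of z] right[of z] ort_swap(1)[of b a z] unfolding c by auto
  qed
  ultimately show thesis by (rule that)
qed

text \<open>If nine points are cut off by a line, the ten others contain a hole; so without two disjoint holes
the nine points are hole-free, as the core argument requires.\<close>

lemma edge_core_exists: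
  assumes gp: "general_position S" and card: "card S = 19" and not2: "\<not> packs 2 S"
    and ab: "hull_edge S a b"
  obtains K where "edge_core S a b K"
proof -
  have in_S: "a \<in> S" "b \<in> S" "a \<noteq> b" and left: "\<And>z. z \<in> S \<Longrightarrow> z \<notin> {a, b} \<Longrightarrow> 0 < 1 * ort a b z"
    using ab unfolding hull_edge_def by auto
  obtain p where p: "bij_betw p {..<card S} S" "p 0 = a"
    "\<And>i j. 0 < i \<Longrightarrow> i < j \<Longrightarrow> j < card S \<Longrightarrow> 0 < 1 * ort (p 0) (p i) (p j)"
    using radial_enumeration[OF gp in_S(1) radial_edge[OF left] one_neq_zero] by blast
  have img: "p ` {..<19} = S" and inj: "inj_on p {..<19}"
    using p(1) unfolding bij_betw_def card by auto
  have lt: "0 < ort a (p i) (p j)" if "0 < i" "i < j" "j < 19" for i j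
    using p(3)[OF that(1,2)] that(3) p(2) card by simp
  have b: "b = p 1"
  proof (rule ccontr)
    assume "b \<noteq> p 1"
    obtain i where i: "i < 19" "b = p i" using img in_S by auto
    then have "i \<noteq> 0" "i \<noteq> 1" using \<open>b \<noteq> p 1\<close> in_S p(2) by metis+
    then have "0 < ort a (p 1) b" using lt[of 1 i] i by simp
    moreover have "p 1 \<noteq> a" using inj_on_eq_iff[OF inj, of 1 0] p(2) by simp
    then have "0 < ort a b (p 1)" using left[of "p 1"] img \<open>b \<noteq> p 1\<close> by auto
    ultimately show False using ort_swap(2)[of a b "p 1"] by simp
  qed
  let ?P = "p ` {..<8}" and ?Y = "p ` {8..<19}"
  have SPY: "S = ?P \<union> ?Y" unfolding image_Un[symmetric] img[symmetric] by (rule arg_cong[of _ _ "image p"]) auto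
  have "{..<8} \<inter> {8..<19} = ({} :: nat set)" "{8..<19} \<subseteq> {..<19::nat}" by auto
  then have disj: "?P \<inter> ?Y = {}" and injY: "inj_on p {8..<19}"
    using inj_on_image_Int[OF inj, of "{..<8}" "{8..<19}"] inj_on_subset[OF inj] by simp_all
  have cardP: "card ?P = 8" using card_image[OF inj_on_subset[OF inj, of "{..<8}"]] by auto
  have cardY: "card ?Y = 11" using card_image[OF injY] by simp
  have free: "hole_free (insert y ?P)"
    if y: "y \<in> ?Y" and sep: "convex hull (insert y ?P) \<inter> convex hull (?Y - {y}) = {}" for y
  proof (rule ccontr)
    assume "\<not> hole_free (insert y ?P)"
    then have "packs 1 (insert y ?P)" by (rule packs_1)
    moreover have "packs 1 (?Y - {y})"
    proof (rule packs_1[OF ten_points_not_hole_free])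
      show "general_position (?Y - {y})" using general_position_subset[OF gp] SPY by blast
      show "card (?Y - {y}) = 10" using y cardY by simp
    qed
    ultimately have "packs (1 + 1) (insert y ?P \<union> (?Y - {y}))" using sep by (rule packs_Un)
    moreover have "insert y ?P \<union> (?Y - {y}) = S" using SPY y by blast
    ultimately show False using not2 unfolding one_add_one by simp
  qed
  have right: "1 * ort b q z < 0" if "q \<in> ?P - {b}" "z \<in> ?Y" for q z
  proof (rule core[OF _ disj cardP one_neq_zero _ _ in_S(3) _ _ _ _ free that])
    show "general_position (?P \<union> ?Y)" using gp SPY by simp
    show "a \<in> ?P" using p(2) by force
    show "b \<in> ?P" using b by auto
    show "p 7 \<in> ?P" by auto
    show "0 < 1 * ort a b z" if "z \<in> ?P \<union> ?Y" "z \<notin> {a, b}" for z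
      using left that SPY by blast
    show "1 * ort a (p 7) q \<le> 0" if q: "q \<in> ?P" for q
    proof -
      obtain i where i: "i < 8" "q = p i" using q by auto
      show ?thesis
      proof (cases "i = 0 \<or> i = 7")
        case False
        then show ?thesis using lt[of i 7] i ort_swap(2)[of a "p 7" "p i"] by simp
      qed (use i p(2) in auto)
    qed
    show "0 < 1 * ort a (p 7) y" if "y \<in> ?Y" for y
      using that lt[of 7] by auto
  qed
  let ?K = "p ` {2..<8}"
  have Pab: "?P = insert a (insert b ?K)"
  proof -
    have "{..<8} = insert 0 (insert 1 {2..<8::nat})" by auto
    then show ?thesis using p(2) b by simp
  qed
  have sub: "{2..<8} \<subseteq> {..<19::nat}" by auto
  have "a \<notin> ?K" "b \<notin> ?K"
    using inj_on_image_mem_iff[OF inj _ sub, of 0] inj_on_image_mem_iff[OF inj _ sub, of 1] p(2) b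
    by simp_all
  then have KP: "?K = ?P - {a, b}" unfolding Pab by (simp add: insert_Diff_if)
  have "edge_core S a b ?K"
    unfolding edge_core_def
  proof (intro conjI ballI)
    show "?K \<subseteq> S - {a, b}" using KP SPY by blast
    have "inj_on p {2..<8}" by (rule inj_on_subset[OF inj sub])
    then show "card ?K = 6" using card_image[of p "{2..<8}"] by simp
    fix k y assume k: "k \<in> ?K" and "y \<in> S - ?K - {a, b}"
    then have y: "y \<in> ?Y" using KP SPY by blast
    then show "0 < ort a k y" using k lt by auto
    show "ort b k y < 0" using right[of k y] k y KP by auto
  qed
  then show thesis by (rule that)
qed

text \<open>If \<open>k\<close> were in both cores, then every point outside the cores and the edges would come after \<open>k\<close> in
the order around \<open>b\<close> in both directions. So there would be no such point, and at most fifteen points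
in all.\<close>

lemma adjacent_cores_disjoint:
  assumes fin: "finite S" and card: "16 \<le> card S"
    and K: "edge_core S a b K" and K': "edge_core S b c K'"
  shows "K \<inter> K' = {}"
proof (rule ccontr)
  assume "K \<inter> K' \<noteq> {}"
  then obtain k where k: "k \<in> K" "k \<in> K'" by blast
  have "S \<subseteq> K \<union> K' \<union> {a, b, c}"
  proof
    fix z assume "z \<in> S"
    show "z \<in> K \<union> K' \<union> {a, b, c}"
    proof (rule ccontr)
      assume "z \<notin> K \<union> K' \<union> {a, b, c}"
      then have "ort b k z < 0" "0 < ort b k z"
        using K K' k \<open>z \<in> S\<close> unfolding edge_core_def by blast+
      then show False by simp
    qed
  qed
  moreover have "finite (K \<union> K' \<union> {a, b, c})"
    using K K' fin unfolding edge_core_def by (auto intro: finite_subset)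
  ultimately have "card S \<le> card (K \<union> K' \<union> {a, b, c})" by (intro card_mono)
  also have "\<dots> \<le> card K + card K' + card {a, b, c}"
    using card_Un_le[of "K \<union> K'" "{a, b, c}"] card_Un_le[of K K'] by linarith
  also have "\<dots> \<le> 15" using K K' unfolding edge_core_def by (simp add: card_insert_if)
  finally show False using card by simp
qed

text \<open>A core point is strictly inside a triangle spanned by points of \<open>S\<close>.\<close>

lemma hull_vertex_not_in_core:
  assumes fin: "finite S" and card: "9 \<le> card S"
    and xy: "hull_edge S x y" and K: "edge_core S x y K" and bc: "hull_edge S b c"
  shows "b \<notin> K"
proof
  assume b: "b \<in> K"
  have KS: "K \<subseteq> S - {x, y}" "card K = 6" using K unfolding edge_core_def by auto
  have "\<not> S \<subseteq> insert x (insert y K)"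
  proof
    assume sub: "S \<subseteq> insert x (insert y K)"
    have "finite K" using KS fin by (auto intro: finite_subset)
    then have "card S \<le> card (insert x (insert y K))" using sub by (intro card_mono) auto
    also have "\<dots> \<le> 8" using KS(2) by (simp add: card_insert_if \<open>finite K\<close>)
    finally show False using card by simp
  qed
  then obtain z where z: "z \<in> S" "z \<notin> K" "z \<noteq> x" "z \<noteq> y" by blast
  have 1: "0 < ort x b z" "ort y b z < 0" using K b z unfolding edge_core_def by blast+
  have 2: "0 < ort x y b" using xy b KS unfolding hull_edge_def by blast
  have "b \<noteq> x" "b \<noteq> y" "b \<noteq> z" using b KS z by auto
  then have f: "w \<noteq> c \<longrightarrow> 0 < ort b c w" "0 \<le> ort b c w" if "w \<in> {x, y, z}" for w
  proof -
    have "w \<in> S - {b, c}" if "w \<noteq> c"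
      using that \<open>w \<in> {x, y, z}\<close> \<open>b \<noteq> x\<close> \<open>b \<noteq> y\<close> \<open>b \<noteq> z\<close> xy z(1) unfolding hull_edge_def by auto
    then show "w \<noteq> c \<longrightarrow> 0 < ort b c w" using bc unfolding hull_edge_def by blast
    then show "0 \<le> ort b c w" by (cases "w = c") auto
  qed
  have "ort y z b * ort b c x + ort z x b * ort b c y + ort x y b * ort b c z = 0"
    using ort_barycentric[of y z b c x] by simp
  moreover have pos: "0 < ort y z b" "0 < ort z x b"
    using 1 ort_swap(2)[of y z b] ort_rotate[of x b z] by simp_all
  moreover have "0 \<le> ort b c x" "0 \<le> ort b c y" "0 \<le> ort b c z" using f by blast+
  ultimately have "ort y z b * ort b c x = 0" "ort z x b * ort b c y = 0"
    using 2 mult_nonneg_nonneg[of "ort y z b" "ort b c x"] mult_nonneg_nonneg[of "ort z x b" "ort b c y"]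
      mult_nonneg_nonneg[of "ort x y b" "ort b c z"] by linarith+
  then have "ort b c x = 0" "ort b c y = 0" using pos by auto
  then have "x = c" "y = c" using f(1)[of x] f(1)[of y] by auto
  then show False using xy unfolding hull_edge_def by simp
qed

text \<open>Three consecutive hull edges have disjoint cores with 18 points in total, and the two vertices
\<open>b\<close> and \<open>c\<close> are in none of them; this needs 20 points. If the hull is a triangle, the first and the
third edge are adjacent too. Otherwise their cores are on different sides of the diagonal \<open>b d\<close>.\<close>

lemma nineteen_points_pack_two:
  assumes gp: "general_position S" and card: "card S = 19"
  shows "packs 2 S"
proof (rule ccontr)
  assume not2: "\<not> packs 2 S"
  have fin: "finite S" by (rule general_position_finite[OF gp])
  have c3: "3 \<le> card S" "2 \<le> card S" using card by auto
  obtain a b where ab: "hull_edge S a b" by (rule exists_hull_edge[OF gp c3(2)])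
  obtain c where bc: "hull_edge S b c" "c \<noteq> a" by (rule next_hull_edge[OF gp c3(1) ab])
  obtain d where cd: "hull_edge S c d" "d \<noteq> b" by (rule next_hull_edge[OF gp c3(1) bc(1)])
  obtain f where df: "hull_edge S d f" by (rule next_hull_edge[OF gp c3(1) cd(1)])
  obtain K1 where K1: "edge_core S a b K1" by (rule edge_core_exists[OF gp card not2 ab])
  obtain K2 where K2: "edge_core S b c K2" by (rule edge_core_exists[OF gp card not2 bc(1)])
  obtain K3 where K3: "edge_core S c d K3" by (rule edge_core_exists[OF gp card not2 cd(1)])
  have c16: "16 \<le> card S" "9 \<le> card S" using card by auto
  have in_S: "a \<in> S" "b \<in> S" "c \<in> S" "d \<in> S" "a \<noteq> b" "b \<noteq> c" "c \<noteq> d"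
    using ab bc(1) cd(1) unfolding hull_edge_def by simp_all
  note vertex = hull_vertex_not_in_core[OF fin c16(2)]
  have d12: "K1 \<inter> K2 = {}" by (rule adjacent_cores_disjoint[OF fin c16(1) K1 K2])
  have d23: "K2 \<inter> K3 = {}" by (rule adjacent_cores_disjoint[OF fin c16(1) K2 K3])
  have d13: "K1 \<inter> K3 = {}"
  proof (cases "d = a")
    case True
    then show ?thesis using adjacent_cores_disjoint[OF fin c16(1) K3[unfolded True] K1] by blast
  next
    case False
    show ?thesis
    proof (rule ccontr)
      assume "K1 \<inter> K3 \<noteq> {}"
      then obtain k where k: "k \<in> K1" "k \<in> K3" by blast
      have "d \<in> S - K1 - {a, b}" using False cd(2) in_S vertex[OF ab K1 df] by simp
      then have "ort b k d < 0" using K1 k unfolding edge_core_def by blast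
      moreover have "b \<in> S - K3 - {c, d}"
        using in_S cd(2) vertex[OF cd(1) K3 bc(1)] by simp
      then have "ort d k b < 0" using K3 k unfolding edge_core_def by blast
      moreover have "ort d k b = - ort b k d" unfolding ort_def by (simp add: algebra_simps)
      ultimately show False by simp
    qed
  qed
  have KS: "K1 \<subseteq> S" "K2 \<subseteq> S" "K3 \<subseteq> S" "card K1 = 6" "card K2 = 6" "card K3 = 6"
    using K1 K2 K3 unfolding edge_core_def by blast+
  have "b \<notin> K1" "b \<notin> K2" "c \<notin> K2" "c \<notin> K3"
    using K1 K2 K3 unfolding edge_core_def by blast+
  then have sub: "K1 \<union> K2 \<union> K3 \<subseteq> S - {b, c}"
    using KS(1-3) vertex[OF ab K1 cd(1)] vertex[OF cd(1) K3 bc(1)] by blast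
  have finK: "finite K1" "finite K2" "finite K3"
    using KS(1-3) fin by (auto intro: finite_subset)
  have "(K1 \<union> K2) \<inter> K3 = {}" using d13 d23 by blast
  then have "card (K1 \<union> K2 \<union> K3) = 18"
    using card_Un_disjoint[OF finK(1,2) d12] card_Un_disjoint[of "K1 \<union> K2" K3] finK KS(4-6) by simp
  moreover have "card (S - {b, c}) = 17"
    using in_S card by (simp add: card_Diff_subset)
  moreover have "card (K1 \<union> K2 \<union> K3) \<le> card (S - {b, c})"
    using sub fin by (intro card_mono) auto
  ultimately show False by simp
qed

section \<open>Forty-seven points\<close>

text \<open>Two parts with two disjoint holes each leave no room for a hole in a part that can be separated
from both of them.\<close>

lemma middle_hole_free:
  assumes not5: "\<not> packs 5 S" and S: "S = L \<union> M \<union> R" and L: "packs 2 L" and R: "packs 2 R"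
    and LR: "convex hull (L \<union> M) \<inter> convex hull R = {}" and LM: "convex hull L \<inter> convex hull M = {}"
  shows "hole_free M"
proof (rule ccontr)
  assume "\<not> hole_free M"
  then have "packs 1 M" by (rule packs_1)
  from packs_Un[OF packs_Un[OF L this LM] R LR] have "packs (2 + 1 + 2) S" unfolding S .
  then show False using not5 by simp
qed

text \<open>Sort the points around a hull vertex \<open>p 0\<close> and consider the middle points \<open>p 19, \<dots>, p 28\<close>. Since
\<open>p 0\<close> may be assigned to the left part, the right part or the middle, there are three hole-free
windows of nine points between two parts of 19 points. The core argument applies to the middle
points and either of the two sides, the other side being kept as a part with two disjoint holes.
It places \<open>p 21, \<dots>, p 26\<close> on the near side of the lines through \<open>p 27\<close> and the points before them
and through \<open>p 20\<close> and the points after them, and the eleven points \<open>p 0, p 19, \<dots>, p 28\<close> become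
the impossible configuration.\<close>

lemma fortyseven_points_pack_five:
  assumes gp: "general_position S" and card: "card S = 47"
  shows "packs 5 S"
proof (rule ccontr)
  assume not5: "\<not> packs 5 S"
  obtain apex where apex: "apex \<in> S" "radial 1 apex S"
    using exists_apex[of S 1] general_position_finite[OF gp] card by fastforce
  obtain p where p: "bij_betw p {..<card S} S" "p 0 = apex"
    "\<And>i j. 0 < i \<Longrightarrow> i < j \<Longrightarrow> j < card S \<Longrightarrow> 0 < 1 * ort (p 0) (p i) (p j)"
    using radial_enumeration[OF gp apex one_neq_zero] by blast
  have img: "p ` {..<47} = S" and inj: "inj_on p {..<47}"
    using p(1) unfolding bij_betw_def card by auto
  have lt: "0 < ort (p 0) (p i) (p j)" if "0 < i" "i < j" "j < 47" for i j
    using p(3)[OF that(1,2)] that(3) card by simp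
  have gt: "ort (p 0) (p j) (p i) < 0" if "0 < i" "i < j" "j < 47" for i j
    using lt[OF that] ort_swap(2)[of "p 0" "p j" "p i"] by simp
  have gp': "general_position (p ` X)" and inj': "inj_on p X" and card': "card (p ` X) = card X"
    if "X \<subseteq> {..<47}" for X
  proof -
    show "general_position (p ` X)" using general_position_subset[OF gp] that img by blast
    show "inj_on p X" by (rule inj_on_subset[OF inj that])
    then show "card (p ` X) = card X" by (rule card_image)
  qed
  have whole: "p ` X \<union> p ` Y \<union> p ` Z = S" if "X \<union> Y \<union> Z = {..<47}" for X Y Z
    using that img by (metis image_Un)
  have two: "packs 2 (p ` X)" if "X \<subseteq> {..<47}" "card X = 19" for X
    using nineteen_points_pack_two[OF gp'] card' that by simp
  \<comment> \<open>Cuts along a line through p 0, which belongs to the first or, in cut0, to the second part.\<close>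
  have cut: "convex hull (p ` X) \<inter> convex hull (p ` Z) = {}"
    if XZ: "X \<subseteq> {..m}" "Z \<subseteq> {m<..<47}" and m: "0 < m" "m < 47" for X Z m
  proof (rule disjoint_hulls[where e = 1 and p = "p 0" and q = "p m"])
    fix x assume "x \<in> p ` X"
    then obtain i where i: "i \<in> X" "x = p i" by blast
    then have "i \<le> m" using XZ(1) by auto
    then consider "i = 0" | "i = m" | "0 < i" "i < m" by linarith
    then show "1 * ort (p 0) (p m) x \<le> 0"
      by cases (use i gt[of i m] m in \<open>auto simp: less_imp_le\<close>)
  next
    fix x assume "x \<in> p ` Z"
    then obtain i where i: "i \<in> Z" "x = p i" by blast
    then have "m < i" "i < 47" using XZ(2) by auto
    then show "0 < 1 * ort (p 0) (p m) x" using lt[of m i] m i by simp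
  qed
  have cut0: "convex hull (p ` Z) \<inter> convex hull (p ` X) = {}"
    if XZ: "X \<subseteq> {0<..<m}" "Z \<subseteq> insert 0 {m..<47}" and m: "m < 47" for X Z m
  proof (rule disjoint_hulls[where e = "- 1" and p = "p 0" and q = "p m"])
    fix x assume "x \<in> p ` Z"
    then obtain i where i: "i \<in> Z" "x = p i" by blast
    then have "i = 0 \<or> m \<le> i \<and> i < 47" using XZ(2) by auto
    then consider "i = 0" | "i = m" | "m = 0" | "0 < m" "m < i" "i < 47" by fastforce
    then show "- 1 * ort (p 0) (p m) x \<le> 0"
      by cases (use i lt[of m i] in \<open>auto simp: less_imp_le\<close>)
  next
    fix x assume "x \<in> p ` X"
    then obtain i where i: "i \<in> X" "x = p i" by blast
    then have "0 < i" "i < m" using XZ(1) by auto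
    then show "0 < - 1 * ort (p 0) (p m) x" using gt[of i m] m i by simp
  qed
  have free0: "hole_free (p ` insert 0 {20..<28})"
  proof (rule middle_hole_free[OF not5])
    show "S = p ` {1..<20} \<union> p ` insert 0 {20..<28} \<union> p ` {28..<47}"
      by (rule whole[symmetric]) auto
    show "convex hull (p ` {1..<20} \<union> p ` insert 0 {20..<28}) \<inter> convex hull (p ` {28..<47}) = {}"
      unfolding image_Un[symmetric] by (rule cut[of _ 27]) auto
    show "convex hull (p ` {1..<20}) \<inter> convex hull (p ` insert 0 {20..<28}) = {}"
      by (subst Int_commute, rule cut0[of _ 20]) auto
    show "packs 2 (p ` {1..<20})" "packs 2 (p ` {28..<47})" by (rule two; auto)+
  qed
  have free1: "hole_free (p ` {19..<28})"
  proof (rule middle_hole_free[OF not5])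
    show "S = p ` {..<19} \<union> p ` {19..<28} \<union> p ` {28..<47}"
      by (rule whole[symmetric]) auto
    show "convex hull (p ` {..<19} \<union> p ` {19..<28}) \<inter> convex hull (p ` {28..<47}) = {}"
      unfolding image_Un[symmetric] by (rule cut[of _ 27]) auto
    show "convex hull (p ` {..<19}) \<inter> convex hull (p ` {19..<28}) = {}"
      by (rule cut[of _ 18]) auto
    show "packs 2 (p ` {..<19})" "packs 2 (p ` {28..<47})" by (rule two; auto)+
  qed
  have free2: "hole_free (p ` {20..<29})"
  proof (rule middle_hole_free[OF not5])
    show "S = p ` {1..<20} \<union> p ` {20..<29} \<union> p ` insert 0 {29..<47}"
      by (rule whole[symmetric]) auto
    show "convex hull (p ` {1..<20} \<union> p ` {20..<29}) \<inter> convex hull (p ` insert 0 {29..<47}) = {}"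
      unfolding image_Un[symmetric] by (subst Int_commute, rule cut0[of _ 29]) auto
    show "convex hull (p ` {1..<20}) \<inter> convex hull (p ` {20..<29}) = {}"
      by (rule cut[of _ 19]) auto
    show "packs 2 (p ` {1..<20})" "packs 2 (p ` insert 0 {29..<47})" by (rule two; auto)+
  qed
  \<comment> \<open>The hull edge from p 0 to p 27 of the points up to p 27, with p 28 to p 46 as the other part.\<close>
  have coreL: "- 1 * ort (p 27) q z < 0" if "q \<in> p ` insert 0 {21..<28} - {p 27}" "z \<in> p ` {1..<21}" for q z
  proof (rule core[where P = "p ` insert 0 {21..<28}" and Y = "p ` {1..<21}" and s = "p 0" and r = "p 21", OF _ _ _ _ _ _ _ _ _ _ _ _ that])
    show "general_position (p ` insert 0 {21..<28} \<union> p ` {1..<21})"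
      unfolding image_Un[symmetric] by (rule gp') auto
    show "p ` insert 0 {21..<28} \<inter> p ` {1..<21} = {}"
      by (subst inj_on_image_Int[OF inj, symmetric]) auto
    show "card (p ` insert 0 {21..<28}) = 8" by (subst card') auto
    show "p 0 \<noteq> p 27" using inj_on_eq_iff[OF inj, of 0 27] by simp
    show "0 < - 1 * ort (p 0) (p 27) z" if z: "z \<in> p ` insert 0 {21..<28} \<union> p ` {1..<21}" "z \<notin> {p 0, p 27}" for z
    proof -
      obtain i where i: "i \<in> insert 0 {21..<28} \<union> {1..<21}" "z = p i" using z(1) by blast
      then have "i \<noteq> 0" "i \<noteq> 27" using z(2) by auto
      then show ?thesis using gt[of i 27] i by auto
    qed
    show "- 1 * ort (p 0) (p 21) q \<le> 0" if q: "q \<in> p ` insert 0 {21..<28}" for q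
    proof -
      obtain i where i: "i \<in> insert 0 {21..<28}" "q = p i" using q by blast
      then have "i = 0 \<or> i = 21 \<or> 21 < i \<and> i < 28" by auto
      then show ?thesis by (elim disjE conjE) (use i(2) lt[of 21 i] in auto)
    qed
    show "0 < - 1 * ort (p 0) (p 21) y" if y: "y \<in> p ` {1..<21}" for y
      using y gt[of _ 21] by auto
    fix y assume y: "y \<in> p ` {1..<21}"
      and sep: "convex hull insert y (p ` insert 0 {21..<28}) \<inter> convex hull (p ` {1..<21} - {y}) = {}"
    obtain i where i: "i \<in> {1..<21}" "y = p i" using y by blast
    have M: "insert y (p ` insert 0 {21..<28}) = p ` insert i (insert 0 {21..<28})" using i by simp
    have L: "p ` {1..<21} - {y} = p ` ({1..<21} - {i})"
    proof -
      have "{1..<21} - {i} \<subseteq> {..<47}" "{i} \<subseteq> {..<47}" using i(1) by auto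
      then show ?thesis unfolding i(2) using inj_on_image_set_diff[OF inj, of "{1..<21}" "{i}"] by simp
    qed
    show "hole_free (insert y (p ` insert 0 {21..<28}))"
      unfolding M
    proof (rule middle_hole_free[OF not5])
      show "S = p ` ({1..<21} - {i}) \<union> p ` insert i (insert 0 {21..<28}) \<union> p ` {28..<47}"
        by (rule whole[symmetric]) (use i(1) in auto)
      show "convex hull (p ` ({1..<21} - {i}) \<union> p ` insert i (insert 0 {21..<28})) \<inter> convex hull (p ` {28..<47}) = {}"
        unfolding image_Un[symmetric] by (rule cut[of _ 27]) (use i(1) in auto)
      show "packs 2 (p ` ({1..<21} - {i}))" by (rule two) (use i(1) in \<open>auto simp: card_Diff_singleton\<close>)
      show "packs 2 (p ` {28..<47})" by (rule two; auto)
    qed (use sep in \<open>simp only: M L Int_commute\<close>)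
  qed auto
  \<comment> \<open>The hull edge from p 0 to p 20 of the points from p 20 on, with p 1 to p 19 as the other part.\<close>
  have coreR: "1 * ort (p 20) q z < 0" if "q \<in> p ` insert 0 {20..<27} - {p 20}" "z \<in> p ` {27..<47}" for q z
  proof (rule core[where P = "p ` insert 0 {20..<27}" and Y = "p ` {27..<47}" and s = "p 0" and r = "p 26", OF _ _ _ _ _ _ _ _ _ _ _ _ that])
    show "general_position (p ` insert 0 {20..<27} \<union> p ` {27..<47})"
      unfolding image_Un[symmetric] by (rule gp') auto
    show "p ` insert 0 {20..<27} \<inter> p ` {27..<47} = {}"
      by (subst inj_on_image_Int[OF inj, symmetric]) auto
    show "card (p ` insert 0 {20..<27}) = 8" by (subst card') auto
    show "p 0 \<noteq> p 20" using inj_on_eq_iff[OF inj, of 0 20] by simp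
    show "0 < 1 * ort (p 0) (p 20) z" if z: "z \<in> p ` insert 0 {20..<27} \<union> p ` {27..<47}" "z \<notin> {p 0, p 20}" for z
    proof -
      obtain i where i: "i \<in> insert 0 {20..<27} \<union> {27..<47}" "z = p i" using z(1) by blast
      then have "i \<noteq> 0" "i \<noteq> 20" using z(2) by auto
      then show ?thesis using lt[of 20 i] i by auto
    qed
    show "1 * ort (p 0) (p 26) q \<le> 0" if q: "q \<in> p ` insert 0 {20..<27}" for q
    proof -
      obtain i where i: "i \<in> insert 0 {20..<27}" "q = p i" using q by blast
      then have "i = 0 \<or> i = 26 \<or> 0 < i \<and> i < 26" by auto
      then show ?thesis by (elim disjE conjE) (use i(2) gt[of i 26] in auto)
    qed
    show "0 < 1 * ort (p 0) (p 26) y" if y: "y \<in> p ` {27..<47}" for y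
      using y lt[of 26] by auto
    fix y assume y: "y \<in> p ` {27..<47}"
      and sep: "convex hull insert y (p ` insert 0 {20..<27}) \<inter> convex hull (p ` {27..<47} - {y}) = {}"
    obtain i where i: "i \<in> {27..<47}" "y = p i" using y by blast
    have M: "insert y (p ` insert 0 {20..<27}) = p ` insert i (insert 0 {20..<27})" using i by simp
    have L: "p ` {27..<47} - {y} = p ` ({27..<47} - {i})"
    proof -
      have "{27..<47} - {i} \<subseteq> {..<47}" "{i} \<subseteq> {..<47}" using i(1) by auto
      then show ?thesis unfolding i(2) using inj_on_image_set_diff[OF inj, of "{27..<47}" "{i}"] by simp
    qed
    show "hole_free (insert y (p ` insert 0 {20..<27}))"
      unfolding M
    proof (rule middle_hole_free[OF not5])
      show "S = p ` ({27..<47} - {i}) \<union> p ` insert i (insert 0 {20..<27}) \<union> p ` {1..<20}"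
        by (rule whole[symmetric]) (use i(1) in auto)
      show "convex hull (p ` ({27..<47} - {i}) \<union> p ` insert i (insert 0 {20..<27})) \<inter> convex hull (p ` {1..<20}) = {}"
        unfolding image_Un[symmetric] by (rule cut0[of _ 20]) (use i(1) in auto)
      show "packs 2 (p ` ({27..<47} - {i}))" by (rule two) (use i(1) in \<open>auto simp: card_Diff_singleton\<close>)
      show "packs 2 (p ` {1..<20})" by (rule two; auto)
    qed (use sep in \<open>simp only: M L Int_commute\<close>)
  qed auto
  \<comment> \<open>The indices of the eleven points.\<close>
  define h where "h i = (if i = 0 then 0 else i + 18)" for i :: nat
  define s where "s i j k \<longleftrightarrow> 0 < 1 * ort (p (h i)) (p (h j)) (p (h k))" for i j k
  have h_mono: "h i < h j" if "i < j" for i j using that unfolding h_def by auto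
  have h_bound: "h i < 47" if "i < 11" for i using that unfolding h_def by auto
  have sub: "general_position ((\<lambda>i. p (h (g i))) ` {..<n})" "inj_on (\<lambda>i. p (h (g i))) {..<n}"
    if "strict_mono g" "\<And>i. i < n \<Longrightarrow> g i < 11" for g :: "nat \<Rightarrow> nat" and n
  proof -
    have "(\<lambda>i. p (h (g i))) ` {..<n} \<subseteq> S" using that h_bound img by auto
    then show "general_position ((\<lambda>i. p (h (g i))) ` {..<n})" by (rule general_position_subset[OF gp])
    have "strict_mono (\<lambda>i. h (g i))" using that(1) h_mono by (simp add: strict_mono_def)
    then show "inj_on (\<lambda>i. p (h (g i))) {..<n}"
    proof (intro inj_onI)
      fix i j assume ij: "i \<in> {..<n}" "j \<in> {..<n}" "p (h (g i)) = p (h (g j))"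
      then have "h (g i) = h (g j)" using inj_onD[OF inj ij(3)] that(2) h_bound by simp
      then show "i = j" using strict_mono_eq[OF \<open>strict_mono (\<lambda>i. h (g i))\<close>] by simp
    qed
  qed
  have id: "strict_mono (\<lambda>i::nat. i)" by (simp add: strict_mono_def)
  have rad: "0 < 1 * ort (p (h 0)) (p (h i)) (p (h j))" if "0 < i" "i < j" "j < 11" for i j
    using lt[of "h i" "h j"] h_mono[of i j] h_mono[of 0 i] h_bound[of j] that by (simp add: h_def)
  have sig: "signotope 11 s" and root: "rooted 11 s"
    by (rule signotope_radial[where p = "\<lambda>i. p (h i)", OF s_def one_neq_zero];
      use sub[OF id, of 11] rad in simp)+
  have filled: "pentagons_filled 9 (\<lambda>i j k. s (g i) (g j) (g k))"
    if g: "strict_mono g" "\<And>i. i < 9 \<Longrightarrow> g i < 11" and free: "hole_free ((\<lambda>i. p (h (g i))) ` {..<9})"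
    for g :: "nat \<Rightarrow> nat"
  proof (rule pentagons_filled_if_hole_free[where p = "\<lambda>i. p (h (g i))" and e = 1])
    show "signotope 9 (\<lambda>i j k. s (g i) (g j) (g k))"
      by (rule signotope_compose[OF sig]) (use g in \<open>auto simp: strict_mono_def\<close>)
  qed (use sub[OF g] free in \<open>simp_all add: s_def\<close>)
  have img_eq: "(\<lambda>i. p (f i)) ` {..<9} = p ` X" if "f ` {..<9} = X" for f :: "nat \<Rightarrow> nat" and X
    using that by auto
  have shift: "(\<lambda>i. i + 19) ` {a..<b} = {a + 19..<b + 19}" for a b :: nat
    by (rule image_add_atLeastLessThan')
  have "pentagons_filled 9 (\<lambda>i j k. s (skip i) (skip j) (skip k))"
  proof (rule filled)
    show "strict_mono skip" unfolding strict_mono_def skip_def by auto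
    have "(\<lambda>i. h (skip i)) ` {..<9} = insert 0 {20..<28}"
    proof -
      have 1: "{..<9} = insert 0 {1..<9::nat}" by auto
      have 2: "(\<lambda>i. h (skip i)) ` {1..<9} = (\<lambda>i. i + 19) ` {1..<9}"
        by (intro image_cong) (auto simp: h_def skip_def)
      show ?thesis unfolding 1 image_insert 2 shift by (simp add: h_def skip_def)
    qed
    then show "hole_free ((\<lambda>i. p (h (skip i))) ` {..<9})" using free0 img_eq by simp
  qed (simp add: skip_def)
  moreover have "pentagons_filled 9 (\<lambda>i j k. s (i + 1) (j + 1) (k + 1))"
  proof (rule filled)
    have "(\<lambda>i. h (i + 1)) ` {..<9} = (\<lambda>i. i + 19) ` {0..<9}"
      by (intro image_cong) (auto simp: h_def)
    then have "(\<lambda>i. h (i + 1)) ` {..<9} = {19..<28}" unfolding shift by simp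
    then show "hole_free ((\<lambda>i. p (h (i + 1))) ` {..<9})" using free1 img_eq by simp
  qed (simp_all add: strict_mono_def)
  moreover have "pentagons_filled 9 (\<lambda>i j k. s (i + 2) (j + 2) (k + 2))"
  proof (rule filled)
    have "(\<lambda>i. h (i + 2)) ` {..<9} = (\<lambda>i. i + 20) ` {0..<9}"
      by (intro image_cong) (auto simp: h_def)
    then have "(\<lambda>i. h (i + 2)) ` {..<9} = {20..<29}"
      unfolding image_add_atLeastLessThan' by simp
    then show "hole_free ((\<lambda>i. p (h (i + 2))) ` {..<9})" using free2 img_eq by simp
  qed (simp_all add: strict_mono_def)
  moreover have "\<forall>k<9. 2 < k \<longrightarrow> \<not> s 1 k 9 \<and> \<not> s 2 k 9 \<and> \<not> s 2 k 10"
  proof (intro allI impI)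
    fix k :: nat assume k: "k < 9" "2 < k"
    have ne: "p (k + 18) \<noteq> p 27" "p (k + 18) \<noteq> p 20"
      using inj_on_eq_iff[OF inj, of "k + 18"] k by auto
    have "- 1 * ort (p 27) (p (k + 18)) (p 19) < 0" "- 1 * ort (p 27) (p (k + 18)) (p 20) < 0"
      using ne k by (intro coreL DiffI imageI; simp)+
    moreover have "1 * ort (p 20) (p (k + 18)) (p 28) < 0"
      using ne k by (intro coreR DiffI imageI; simp)
    moreover have "ort (p 27) (p (k + 18)) z = - ort z (p (k + 18)) (p 27)" for z
      unfolding ort_def by (simp add: algebra_simps)
    ultimately show "\<not> s 1 k 9 \<and> \<not> s 2 k 9 \<and> \<not> s 2 k 10"
      unfolding s_def h_def using k by simp
  qed
  ultimately show False using eleven_points_impossible[OF sig root] by blast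
qed

section \<open>The lower bound\<close>

definition guarantees :: "nat \<Rightarrow> nat \<Rightarrow> bool" where
  "guarantees m k \<longleftrightarrow> (\<forall>S. general_position S \<longrightarrow> m \<le> card S \<longrightarrow> packs k S)"

lemma guarantees_mono: "guarantees m k \<Longrightarrow> m \<le> n \<Longrightarrow> guarantees n k"
  unfolding guarantees_def by auto

lemma guarantees_0: "guarantees m 0"
  unfolding guarantees_def using packs_0 by blast

lemma guarantees_add:
  assumes "guarantees m j" "guarantees n k" "2 \<le> m"
  shows "guarantees (m + n) (j + k)"
  unfolding guarantees_def
proof (intro allI impI)
  fix S assume gp: "general_position S" and card: "m + n \<le> card S"
  have fin: "finite S" by (rule general_position_finite[OF gp])
  have "m \<le> card S" using card by simp
  then obtain A where A: "A \<subseteq> S" "card A = m" "convex hull A \<inter> convex hull (S - A) = {}"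
    using split_off[OF gp assms(3)] by blast
  have "card (S - A) = card S - m" using A(1,2) fin by (simp add: card_Diff_subset finite_subset)
  then have "packs k (S - A)"
    using assms(2) general_position_subset[OF gp, of "S - A"] card unfolding guarantees_def by simp
  moreover have "packs j A"
    using assms(1) general_position_subset[OF gp A(1)] A(2) unfolding guarantees_def by simp
  ultimately have "packs (j + k) (A \<union> (S - A))" by (intro packs_Un A(3))
  moreover have "A \<union> (S - A) = S" using A(1) by blast
  ultimately show "packs (j + k) S" by simp
qed

lemma guarantees_if_exact:
  assumes exact: "\<And>S. general_position S \<Longrightarrow> card S = m \<Longrightarrow> packs k S" and m: "2 \<le> m"
  shows "guarantees m k"
  unfolding guarantees_def
proof (intro allI impI)
  fix S assume gp: "general_position S" and card: "m \<le> card S"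
  obtain A where A: "A \<subseteq> S" "card A = m" "convex hull A \<inter> convex hull (S - A) = {}"
    using split_off[OF gp m card] by blast
  have "packs k (A \<union> (S - A))"
    by (rule packs_Un_left[OF exact[OF general_position_subset[OF gp A(1)] A(2)] A(3)])
  moreover have "A \<union> (S - A) = S" using A(1) by blast
  ultimately show "packs k S" by simp
qed

lemma guarantees_10: "guarantees 10 1"
  by (rule guarantees_if_exact[OF packs_1[OF ten_points_not_hole_free]]) auto

lemma guarantees_19: "guarantees 19 2"
  by (rule guarantees_if_exact[OF nineteen_points_pack_two]) auto

lemma guarantees_47_multiple: "guarantees (47 * q) (5 * q)"
proof (induction q)
  case (Suc q)
  have "guarantees 47 5"
    by (rule guarantees_if_exact[OF fortyseven_points_pack_five]) auto
  then have "guarantees (47 + 47 * q) (5 + 5 * q)" using Suc by (rule guarantees_add) simp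
  then show ?case by simp
qed (simp add: guarantees_0)

text \<open>The values 10, 19, 29 and 38 are the least numbers of points at which \<open>\<lfloor>5 r / 47\<rfloor>\<close> reaches 1, 2,
3 and 4, and \<open>29 = 10 + 19\<close> and \<open>38 = 19 + 19\<close>.\<close>

lemma guarantees_less_47:
  assumes "r < 47" shows "guarantees r (5 * r div 47)"
proof -
  have "10 + 19 = (29::nat)" "1 + 2 = (3::nat)" "19 + 19 = (38::nat)" "2 + 2 = (4::nat)" by simp_all
  then have 29: "guarantees 29 3" and 38: "guarantees 38 4"
    using guarantees_add[OF guarantees_10 guarantees_19] guarantees_add[OF guarantees_19 guarantees_19]
    by (simp_all only:)
  consider "r < 10" | "10 \<le> r" "r < 19" | "19 \<le> r" "r < 29" | "29 \<le> r" "r < 38" | "38 \<le> r"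
    by linarith
  then show ?thesis
  proof cases
    case 1
    then have "5 * r div 47 = 0" by simp
    then show ?thesis by (simp add: guarantees_0)
  next
    case 2
    then have "5 * r div 47 = 1" by (intro div_nat_eqI) auto
    then show ?thesis using guarantees_mono[OF guarantees_10 2(1)] by simp
  next
    case 3
    then have "5 * r div 47 = 2" by (intro div_nat_eqI) auto
    then show ?thesis using guarantees_mono[OF guarantees_19 3(1)] by simp
  next
    case 4
    then have "5 * r div 47 = 3" by (intro div_nat_eqI) auto
    then show ?thesis using guarantees_mono[OF 29 4(1)] by simp
  next
    case 5
    then have "5 * r div 47 = 4" using assms by (intro div_nat_eqI) auto
    then show ?thesis using guarantees_mono[OF 38 5] by simp
  qed
qed

lemma guarantees_div: "guarantees n (5 * n div 47)"
proof (cases "n < 47")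
  case False
  define q r where "q = n div 47" and "r = n mod 47"
  have n: "n = 47 * q + r" unfolding q_def r_def by simp
  have r: "r < 47" unfolding r_def by simp
  have q: "2 \<le> 47 * q" using n r False by (cases q) auto
  have "guarantees (47 * q + r) (5 * q + 5 * r div 47)"
    by (rule guarantees_add[OF guarantees_47_multiple guarantees_less_47[OF r] q])
  moreover have "5 * n div 47 = 5 * q + 5 * r div 47"
    using div_mult_self2[of 47 "5 * r" "5 * q"] unfolding n by (simp add: algebra_simps)
  ultimately show ?thesis using n by simp
qed (rule guarantees_less_47)

text \<open>Points on a parabola. They are needed because the infimum in the definition of \<open>F\<close> would be \<open>0\<close>
for an empty set.\<close>

lemma exists_general_position: "\<exists>S. general_position S \<and> card S = n"
proof -
  define f :: "nat \<Rightarrow> real^2" where "f i = vector [real i, (real i)\<^sup>2]" for i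
  have inj: "inj f" unfolding inj_def f_def vec2_eq_iff by simp
  have "general_position (f ` {..<n})"
    unfolding general_position_def
  proof (intro conjI allI impI)
    fix T assume T: "T \<subseteq> f ` {..<n}" "card T = 3"
    then obtain a b c where abc: "T = {a, b, c}" "a \<noteq> b" "b \<noteq> c" "a \<noteq> c"
      using T(2) unfolding card_3_iff by blast
    then have "a \<in> range f" "b \<in> range f" "c \<in> range f" using T(1) by blast+
    then obtain i j k where "a = f i" "b = f j" "c = f k" by blast
    then have ijk: "T = {f i, f j, f k}" "i \<noteq> j" "j \<noteq> k" "i \<noteq> k" using abc by blast+
    have "ort (f i) (f j) (f k) = (real j - real i) * (real k - real i) * (real k - real j)"
      unfolding ort_def f_def by (simp add: algebra_simps power2_eq_square)
    then have "ort (f i) (f j) (f k) \<noteq> 0" using ijk by simp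
    then show "\<not> collinear T" unfolding ijk(1) using collinear_imp_ort_0 by blast
  qed simp
  moreover have "card (f ` {..<n}) = n" using card_image[OF inj_on_subset[OF inj subset_UNIV]] by simp
  ultimately show ?thesis by blast
qed

lemma packs_imp_max_disjoint_holes:
  assumes fin: "finite S" and packs: "packs k S"
  shows "k \<le> max_disjoint_holes 5 S"
proof -
  let ?C = "{card \<H> |\<H>. disjoint_holes 5 S \<H>}"
  have "\<H> \<in> Pow (Pow S)" if "disjoint_holes 5 S \<H>" for \<H>
    using that unfolding disjoint_holes_def is_hole_def by auto
  then have "?C \<subseteq> card ` Pow (Pow S)" by auto
  moreover have "finite (card ` Pow (Pow S))" using fin by simp
  ultimately have "finite ?C" by (rule finite_subset)
  moreover have "k \<in> ?C" using packs unfolding packs_def by auto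
  ultimately show ?thesis unfolding max_disjoint_holes_def by (rule Max_ge)
qed

theorem theorem4:
  fixes n :: nat
  assumes "n > 0"
  shows "int (F 5 n) \<ge> \<lfloor>5 * real n / 47\<rfloor>"
proof -
  let ?X = "{max_disjoint_holes 5 S |S. general_position S \<and> card S = n}"
  have "5 * n div 47 \<le> m" if m: "m \<in> ?X" for m
  proof -
    obtain S where S: "m = max_disjoint_holes 5 S" "general_position S" "card S = n"
      using m by blast
    then have "packs (5 * n div 47) S" using guarantees_div unfolding guarantees_def by blast
    then show ?thesis
      unfolding S(1) by (rule packs_imp_max_disjoint_holes[OF general_position_finite[OF S(2)]])
  qed
  moreover have "?X \<noteq> {}" using exists_general_position by blast
  ultimately have "5 * n div 47 \<le> F 5 n" unfolding F_def by (intro cInf_greatest)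
  moreover have "\<lfloor>5 * real n / 47\<rfloor> = int (5 * n div 47)"
    using floor_divide_of_nat_eq[of "5 * n" 47, where 'a = real] by simp
  ultimately show ?thesis by simp
qed

end
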